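(* Let $(S,+,\ell)$ be an adequate partial layered semigroup with $\delta$ layers and let $\mathcal F$ be a locally finite collection of regressive maps on $S$. If $\Pi_S$ contains an $\mathcal F$-coherent element $(\alpha_i)_{i<\delta}$, then $S$ is $\mathcal F$-Ramsey.
   Context: Nonstandard framework: a universe with a star map $M\mapsto{}^*M$ (iterable: ${}^{*k}M$) satisfying the usual properties (${}^*A\supseteq\{{}^*x:x\in A\}$ for sets, monotonicity, ${}^*(A^k)=({}^*A)^k$, functions extend to their stars, ${}^*s=s$ for $s\in S$, ${}^*n=n$ for $n\in\mathbb N$) and the transfer principle for bounded-quantifier formulas; the nonstandard universe is assumed saturated enough that ${}^*S$ is compact in the topology generated by the sets ${}^*B$, $B\subseteq S$. Extensions of $+$ and of maps $f$ are denoted by the same symbols. For $\alpha\in{}^{*m}S$ let $\mathcal U_\alpha=\{B\subseteq S:\alpha\in{}^{*m}B\}$; $\alpha\sim\beta$ iff $\mathcal U_\alpha=\mathcal U_\beta$. Write $\alpha\preccurlyeq\beta$ iff $\alpha+{}^*\beta\sim\beta+{}^*\alpha\sim\alpha$. An adequate partial layered semigroup is a partial semigroup $(S,+)$ with $\ell:S\to\mathbb N$ whose range is an initial segment of $\mathbb N$ of size $\delta\in\mathbb N\cup\{\omega\}$ (the number of layers), layers $S_i=\ell^{-1}(i)$, $S_{\le i}=\ell^{-1}(\{0,\dots,i\})$, such that $\ell(s+t)=\max\{\ell(s),\ell(t)\}$ whenever $s+t$ is defined, and for all $s_1,\dots,s_n\in S_i$ there is $t\in S_i$ with all $s_j+t$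 defined. For $B\subseteq S$, ${}^\gamma B=\{\alpha\in{}^*B: x+\alpha$ defined for all $x\in B\}$; $\Pi_S=\prod_{i<\delta}{}^\gamma S_i$. A regressive map is $f:S\to S$ with: $f(s+t)=f(s)+f(t)$; $\ell(f(s))\le\ell(s)$; $\ell(s)\le\ell(t)\Rightarrow\ell(f(s))\le\ell(f(t))$; $|\ell(f(s))-\ell(f(t))|\le|\ell(s)-\ell(t)|$. $\mathcal F$ is locally finite if each $\{f|_{S_{\le i}}:f\in\mathcal F\}$ is finite. $(\alpha_i)_{i<\delta}\in\Pi_S$ is $\mathcal F$-coherent if for all $f\in\mathcal F$, $j<\delta$ there is $k\le j$ with $f(\alpha_j)\sim\alpha_k$; it is $\mathcal F$-Ramsey if moreover $\alpha_j\preccurlyeq\alpha_i$ for all $i\le j<\delta$. $S$ is $\mathcal F$-Ramsey if $\Pi_S$ contains an $\mathcal F$-Ramsey element.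
   Formalization: In the definition of ^γB, "x+α defined for all x in B" is read as "for all x in S"; with x in B only, the claim fails for S={0,1}, 0+0=0, 1+1=1, other sums undefined, ℓ(i)=i. *)

theory Defs
  imports "HOL-Analysis.Analysis"
begin

section \<open>Bounded-quantifier formulas of the language of set theory\<close>

text \<open>
  Variables are natural numbers; \<open>BAll n i \<phi>\<close> is the bounded quantification
  \<open>\<forall>v\<^sub>n \<in> v\<^sub>i. \<phi>\<close>. Parameters are supplied by the assignment \<open>e\<close>.
\<close>

datatype bformula =
    BEq nat nat
  | BMem nat nat
  | BNot bformula
  | BAnd bformula bformula
  | BAll nat nat bformula

primrec bsat :: "('u \<Rightarrow> 'u \<Rightarrow> bool) \<Rightarrow> bformula \<Rightarrow> (nat \<Rightarrow> 'u) \<Rightarrow> bool" where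
  "bsat E (BEq i j) e \<longleftrightarrow> e i = e j"
| "bsat E (BMem i j) e \<longleftrightarrow> E (e i) (e j)"
| "bsat E (BNot \<phi>) e \<longleftrightarrow> \<not> bsat E \<phi> e"
| "bsat E (BAnd \<phi> \<psi>) e \<longleftrightarrow> bsat E \<phi> e \<and> bsat E \<psi> e"
| "bsat E (BAll n i \<phi>) e \<longleftrightarrow> (\<forall>x. E x (e i) \<longrightarrow> bsat E \<phi> (e(n := x)))"


section \<open>The nonstandard universe\<close>

text \<open>
  The universe is the type \<open>'u\<close>; its objects are atoms (\<open>Atoms\<close>) and sets, \<open>Mem\<close> is the
  membership relation, \<open>star\<close> the star map of the universe into itself (so that it can be
  iterated), and \<open>num\<close> the embedding of the natural numbers.
\<close>

record 'u nsu =
  Mem :: "'u \<Rightarrow> 'u \<Rightarrow> bool"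
  Atoms :: "'u set"
  star :: "'u \<Rightarrow> 'u"
  num :: "nat \<Rightarrow> 'u"

definition elts :: "('u, 'z) nsu_scheme \<Rightarrow> 'u \<Rightarrow> 'u set" where
  "elts U a = {x. Mem U x a}"

definition in_univ :: "('u, 'z) nsu_scheme \<Rightarrow> 'u set \<Rightarrow> bool" where
  "in_univ U A \<longleftrightarrow> (\<exists>a. a \<notin> Atoms U \<and> elts U a = A)"

definition coll :: "('u, 'z) nsu_scheme \<Rightarrow> 'u set \<Rightarrow> 'u" where
  "coll U A = (THE a. a \<notin> Atoms U \<and> elts U a = A)"

text \<open>Kuratowski pairs inside the universe.\<close>

definition kpair :: "('u, 'z) nsu_scheme \<Rightarrow> 'u \<Rightarrow> 'u \<Rightarrow> 'u" where
  "kpair U x y = coll U {coll U {x}, coll U {x, y}}"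

text \<open>
  The universe contains with a set all of its subsets (internal or not), and it is closed under
  pairing, binary union and cartesian product. Superstructures have these properties.
  Closure under power sets is deliberately not required: it would force the single type \<open>'u\<close>
  to contain all finitely iterated power sets of the naturals, and no type can be proved in HOL
  to be that large.
\<close>

definition set_universe :: "('u, 'z) nsu_scheme \<Rightarrow> bool" where
  "set_universe U \<longleftrightarrow>
     (\<forall>x a. Mem U x a \<longrightarrow> a \<notin> Atoms U) \<and>
     (\<forall>a b. a \<notin> Atoms U \<longrightarrow> b \<notin> Atoms U \<longrightarrow> elts U a = elts U b \<longrightarrow> a = b) \<and>
     (\<forall>A B. in_univ U A \<longrightarrow> B \<subseteq> A \<longrightarrow> in_univ U B) \<and>
     (\<forall>a b. in_univ U {a, b}) \<and>
     (\<forall>A B. in_univ U A \<longrightarrow> in_univ U B \<longrightarrow> in_univ U (A \<union> B)) \<and>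
     (\<forall>A B. in_univ U A \<longrightarrow> in_univ U B \<longrightarrow> in_univ U {kpair U x y | x y. x \<in> A \<and> y \<in> B}) \<and>
     inj (num U) \<and> in_univ U (range (num U))"

text \<open>The hyper-extension of a set \<open>A\<close> of the universe; \<open>hypk U k A\<close> is its \<open>k\<close>-fold iterate.\<close>

definition hyp :: "('u, 'z) nsu_scheme \<Rightarrow> 'u set \<Rightarrow> 'u set" where
  "hyp U A = elts U (star U (coll U A))"

definition hypk :: "('u, 'z) nsu_scheme \<Rightarrow> nat \<Rightarrow> 'u set \<Rightarrow> 'u set" where
  "hypk U k = (hyp U ^^ k)"

definition transfer_principle :: "('u, 'z) nsu_scheme \<Rightarrow> bool" where
  "transfer_principle U \<longleftrightarrow>
     (\<forall>\<phi> e. bsat (Mem U) \<phi> e \<longleftrightarrow> bsat (Mem U) \<phi> (\<lambda>i. star U (e i)))"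

text \<open>
  The framework for a set \<open>S\<close>. Monotonicity of the star map, its compatibility with finite
  products, and the extension of functions to functions are consequences of transfer.
\<close>

definition nonstandard_framework :: "('u, 'z) nsu_scheme \<Rightarrow> 'u set \<Rightarrow> bool" where
  "nonstandard_framework U S \<longleftrightarrow>
     set_universe U \<and>
     (\<forall>a. a \<notin> Atoms U \<longrightarrow> star U a \<notin> Atoms U) \<and>
     transfer_principle U \<and>
     (\<forall>n. star U (num U n) = num U n) \<and>
     in_univ U S \<and> (\<forall>s\<in>S. star U s = s) \<and>
     compact_space (topology_generated_by {hyp U B | B. B \<subseteq> S})"


section \<open>Partial layered semigroups\<close>

text \<open>A sum is undefined iff \<open>psum\<close> returns \<open>None\<close>.\<close>

record 'a layered =
  carr :: "'a set"
  psum :: "'a \<Rightarrow> 'a \<Rightarrow> 'a option"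
  lay :: "'a \<Rightarrow> nat"

text \<open>Associativity: if one of the two sides is defined, then so is the other, and they agree.\<close>

definition partial_semigroup :: "('a, 'z) layered_scheme \<Rightarrow> bool" where
  "partial_semigroup L \<longleftrightarrow>
     (\<forall>x\<in>carr L. \<forall>y\<in>carr L. \<forall>z. psum L x y = Some z \<longrightarrow> z \<in> carr L) \<and>
     (\<forall>x\<in>carr L. \<forall>y\<in>carr L. \<forall>z\<in>carr L.
        Option.bind (psum L x y) (\<lambda>u. psum L u z) = Option.bind (psum L y z) (\<lambda>v. psum L x v))"

definition layer :: "('a, 'z) layered_scheme \<Rightarrow> nat \<Rightarrow> 'a set" where
  "layer L i = {s \<in> carr L. lay L s = i}"

definition layers_upto :: "('a, 'z) layered_scheme \<Rightarrow> nat \<Rightarrow> 'a set" where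
  "layers_upto L i = {s \<in> carr L. lay L s \<le> i}"

definition adequate_partial_layered_semigroup ::
    "('a, 'z) layered_scheme \<Rightarrow> enat \<Rightarrow> bool" where
  "adequate_partial_layered_semigroup L \<delta> \<longleftrightarrow>
     partial_semigroup L \<and>
     lay L ` carr L = {i. enat i < \<delta>} \<and>
     (\<forall>s\<in>carr L. \<forall>t\<in>carr L. \<forall>u. psum L s t = Some u \<longrightarrow> lay L u = max (lay L s) (lay L t)) \<and>
     (\<forall>i. enat i < \<delta> \<longrightarrow>
        (\<forall>A. finite A \<and> A \<subseteq> layer L i \<longrightarrow> (\<exists>t\<in>layer L i. \<forall>s\<in>A. psum L s t \<noteq> None)))"

definition regressive :: "('a, 'z) layered_scheme \<Rightarrow> ('a \<Rightarrow> 'a) \<Rightarrow> bool" where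
  "regressive L f \<longleftrightarrow>
     f \<in> carr L \<rightarrow> carr L \<and>
     (\<forall>s\<in>carr L. \<forall>t\<in>carr L. \<forall>u. psum L s t = Some u \<longrightarrow> psum L (f s) (f t) = Some (f u)) \<and>
     (\<forall>s\<in>carr L. lay L (f s) \<le> lay L s) \<and>
     (\<forall>s\<in>carr L. \<forall>t\<in>carr L. lay L s \<le> lay L t \<longrightarrow> lay L (f s) \<le> lay L (f t)) \<and>
     (\<forall>s\<in>carr L. \<forall>t\<in>carr L.
        \<bar>int (lay L (f s)) - int (lay L (f t))\<bar> \<le> \<bar>int (lay L s) - int (lay L t)\<bar>)"

definition locally_finite :: "('a, 'z) layered_scheme \<Rightarrow> ('a \<Rightarrow> 'a) set \<Rightarrow> bool" where
  "locally_finite L \<F> \<longleftrightarrow> (\<forall>i. finite ((\<lambda>f. restrict f (layers_upto L i)) ` \<F>))"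


section \<open>Hyper-extensions of the semigroup and Ramsey elements\<close>

text \<open>The extension of the partial sum to the \<open>m\<close>-fold hyper-extension of the carrier.\<close>

definition sum_graph :: "('u, 'z) nsu_scheme \<Rightarrow> ('u, 'y) layered_scheme \<Rightarrow> 'u set" where
  "sum_graph U L =
     {kpair U (kpair U s t) u | s t u. s \<in> carr L \<and> t \<in> carr L \<and> psum L s t = Some u}"

definition hsum ::
    "('u, 'z) nsu_scheme \<Rightarrow> ('u, 'y) layered_scheme \<Rightarrow> nat \<Rightarrow> 'u \<Rightarrow> 'u \<Rightarrow> 'u option" where
  "hsum U L m \<alpha> \<beta> =
     (if \<exists>\<gamma>. kpair U (kpair U \<alpha> \<beta>) \<gamma> \<in> hypk U m (sum_graph U L)
      then Some (THE \<gamma>. kpair U (kpair U \<alpha> \<beta>) \<gamma> \<in> hypk U m (sum_graph U L))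
      else None)"

definition happ ::
    "('u, 'z) nsu_scheme \<Rightarrow> ('u, 'y) layered_scheme \<Rightarrow> ('u \<Rightarrow> 'u) \<Rightarrow> 'u \<Rightarrow> 'u" where
  "happ U L f \<alpha> = (THE \<beta>. kpair U \<alpha> \<beta> \<in> hyp U {kpair U s (f s) | s. s \<in> carr L})"

definition ultra ::
    "('u, 'z) nsu_scheme \<Rightarrow> ('u, 'y) layered_scheme \<Rightarrow> nat \<Rightarrow> 'u \<Rightarrow> 'u set set" where
  "ultra U L m \<alpha> = {B. B \<subseteq> carr L \<and> \<alpha> \<in> hypk U m B}"

text \<open>\<open>hequiv U L m \<alpha> n \<beta>\<close> is \<open>\<alpha> \<sim> \<beta>\<close>, for \<open>\<alpha>\<close> of level \<open>m\<close> and \<open>\<beta>\<close> of level \<open>n\<close>.\<close>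

definition hequiv ::
    "('u, 'z) nsu_scheme \<Rightarrow> ('u, 'y) layered_scheme \<Rightarrow> nat \<Rightarrow> 'u \<Rightarrow> nat \<Rightarrow> 'u \<Rightarrow> bool" where
  "hequiv U L m \<alpha> n \<beta> \<longleftrightarrow>
     \<alpha> \<in> hypk U m (carr L) \<and> \<beta> \<in> hypk U n (carr L) \<and> ultra U L m \<alpha> = ultra U L n \<beta>"

text \<open>
  For \<open>\<alpha>\<close>, \<open>\<beta>\<close> of level 1: both sums are taken at level 2, and both must be defined.
\<close>

definition hpreceq ::
    "('u, 'z) nsu_scheme \<Rightarrow> ('u, 'y) layered_scheme \<Rightarrow> 'u \<Rightarrow> 'u \<Rightarrow> bool" where
  "hpreceq U L \<alpha> \<beta> \<longleftrightarrow>
     (\<exists>\<gamma> \<gamma>'. hsum U L 2 \<alpha> (star U \<beta>) = Some \<gamma> \<and> hsum U L 2 \<beta> (star U \<alpha>) = Some \<gamma>' \<and>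
        hequiv U L 2 \<gamma> 2 \<gamma>' \<and> hequiv U L 2 \<gamma>' 1 \<alpha>)"

text \<open>
  The summand \<open>x\<close> ranges over the whole carrier \<open>S\<close>, as usual for adequate partial semigroups,
  and not just over \<open>B\<close>. With \<open>x \<in> B\<close> only, nothing would relate different layers: for
  \<open>S = {0, 1}\<close> with \<open>0 + 0 = 0\<close>, \<open>1 + 1 = 1\<close>, all other sums undefined and
  \<open>lay i = i\<close>, the pair \<open>(0, 1)\<close> would be a coherent element, although
  \<open>1 + 0\<close> is undefined and hence there is no Ramsey element.
\<close>

definition gam :: "('u, 'z) nsu_scheme \<Rightarrow> ('u, 'y) layered_scheme \<Rightarrow> 'u set \<Rightarrow> 'u set" where
  "gam U L B = {\<alpha> \<in> hyp U B. \<forall>x\<in>carr L. hsum U L 1 x \<alpha> \<noteq> None}"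

definition Pi_gam ::
    "('u, 'z) nsu_scheme \<Rightarrow> ('u, 'y) layered_scheme \<Rightarrow> enat \<Rightarrow> (nat \<Rightarrow> 'u) set" where
  "Pi_gam U L \<delta> = (\<Pi>\<^sub>E i\<in>{i. enat i < \<delta>}. gam U L (layer L i))"

definition coherent_element ::
    "('u, 'z) nsu_scheme \<Rightarrow> ('u, 'y) layered_scheme \<Rightarrow> enat \<Rightarrow> ('u \<Rightarrow> 'u) set \<Rightarrow> (nat \<Rightarrow> 'u) \<Rightarrow> bool"
  where
  "coherent_element U L \<delta> \<F> \<alpha> \<longleftrightarrow>
     \<alpha> \<in> Pi_gam U L \<delta> \<and>
     (\<forall>f\<in>\<F>. \<forall>j. enat j < \<delta> \<longrightarrow> (\<exists>k\<le>j. hequiv U L 1 (happ U L f (\<alpha> j)) 1 (\<alpha> k)))"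

definition ramsey_element ::
    "('u, 'z) nsu_scheme \<Rightarrow> ('u, 'y) layered_scheme \<Rightarrow> enat \<Rightarrow> ('u \<Rightarrow> 'u) set \<Rightarrow> (nat \<Rightarrow> 'u) \<Rightarrow> bool"
  where
  "ramsey_element U L \<delta> \<F> \<alpha> \<longleftrightarrow>
     coherent_element U L \<delta> \<F> \<alpha> \<and>
     (\<forall>i j. i \<le> j \<longrightarrow> enat j < \<delta> \<longrightarrow> hpreceq U L (\<alpha> j) (\<alpha> i))"

definition is_ramsey ::
    "('u, 'z) nsu_scheme \<Rightarrow> ('u, 'y) layered_scheme \<Rightarrow> enat \<Rightarrow> ('u \<Rightarrow> 'u) set \<Rightarrow> bool" where
  "is_ramsey U L \<delta> \<F> \<longleftrightarrow> (\<exists>\<alpha>\<in>Pi_gam U L \<delta>. ramsey_element U L \<delta> \<F> \<alpha>)"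

end

theory Submission
  imports Defs
begin

text \<open>
  By compactness of the hyper-extension of \<open>S\<close>, the types \<open>\<U>\<^sub>\<alpha>\<close> are exactly the ultrafilters on \<open>S\<close>, and
  \<open>\<alpha> + \<^sup>*\<beta>\<close> generates the usual sum of the ultrafilters of \<open>\<alpha>\<close> and \<open>\<beta>\<close>. So the theorem is about the
  compact right topological semigroup of cofinal ultrafilters. A regressive map induces a map \<open>g\<close>
  on layers with \<open>g 0 = 0\<close> and \<open>g (i + 1) \<in> {g i, g i + 1}\<close>; coherence says that \<open>f\<close> maps the
  \<open>i\<close>-th ultrafilter to the \<open>g i\<close>-th one.

  Ellis' lemma, applied to closed semigroups of coherent sequences, gives idempotent coherent
  sequences. If \<open>x\<close> is one, then \<open>x j + \<dots> + x k\<close> is again coherent in \<open>j\<close>, because its image under \<open>f\<close>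
  is \<open>x (g j) + \<dots> + x (g k)\<close> with repeated terms, and these collapse by idempotence. Doing this
  for \<open>k = 0, 1, \<dots>\<close> and keeping the terms already treated fixed yields a coherent \<open>u\<close> with
  \<open>u j + u i = u j\<close> for \<open>i \<le> j\<close>. The sums \<open>u 0 + \<dots> + u j\<close> then absorb each other on both sides.
\<close>

section \<open>Idempotents in compact right topological semigroups\<close>

text \<open>By Zorn's lemma and compactness there is a minimal nonempty closed subsemigroup
  \<open>A\<close>. For \<open>a\<close> in \<open>A\<close>, minimality gives first
  \<open>A a = A\<close>, so some \<open>x\<close> satisfies \<open>x a = a\<close>, and then that
  all \<open>x\<close> in \<open>A\<close> do; take \<open>x = a\<close>.\<close>

lemma ellis_idempotent:
  assumes comp: "compact_space T" and haus: "Hausdorff_space T"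
    and S: "closedin T S" "S \<noteq> {}"
    and mult: "\<And>a b. a \<in> S \<Longrightarrow> b \<in> S \<Longrightarrow> m a b \<in> S"
    and assoc: "\<And>a b c. a \<in> S \<Longrightarrow> b \<in> S \<Longrightarrow> c \<in> S \<Longrightarrow> m (m a b) c = m a (m b c)"
    and cont: "\<And>b. b \<in> S \<Longrightarrow> continuous_map T T (\<lambda>a. m a b)"
  obtains e where "e \<in> S" "m e e = e"
proof -
  define \<A> where "\<A> = {A. closedin T A \<and> A \<noteq> {} \<and> A \<subseteq> S \<and> (\<forall>a\<in>A. \<forall>b\<in>A. m a b \<in> A)}"
  \<comment> \<open>Complements turn the maximal elements of Zorn's lemma into minimal sets.\<close>
  have "\<exists>M\<in>uminus ` \<A>. \<forall>X\<in>uminus ` \<A>. M \<subseteq> X \<longrightarrow> X = M"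
  proof (rule subset_Zorn_nonempty)
    show "uminus ` \<A> \<noteq> {}"
      using S mult by (auto simp: \<A>_def)
    fix \<C> assume ne: "\<C> \<noteq> {}" and ch: "subset.chain (uminus ` \<A>) \<C>"
    define \<D> where "\<D> = uminus ` \<C>"
    have DA: "\<D> \<subseteq> \<A>" and Dch: "\<And>A B. A \<in> \<D> \<Longrightarrow> B \<in> \<D> \<Longrightarrow> A \<subseteq> B \<or> B \<subseteq> A" and Dne: "\<D> \<noteq> {}"
      using ch ne by (auto simp: \<D>_def subset.chain_def)
    \<comment> \<open>A finite nonempty subfamily of a chain contains its own intersection; hence
      the finite intersection property.\<close>
    have fin: "F = {} \<or> \<Inter>F \<in> F" if "finite F" "F \<subseteq> \<D>" for F
      using that
    proof (induction F)
      case (insert A F)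
      then consider "F = {}" | "\<Inter>F \<in> F" "A \<subseteq> \<Inter>F \<or> \<Inter>F \<subseteq> A"
        using Dch[of A "\<Inter>F"] by blast
      then show ?case
        by cases (auto simp: inf_absorb1 inf_absorb2 simp del: Inf_lower)
    qed simp
    have "\<Inter>\<D> \<noteq> {}"
    proof -
      have "\<forall>C\<in>\<D>. closedin T C"
        using DA by (auto simp: \<A>_def)
      moreover have "\<Inter>F \<noteq> {}" if "finite F" "F \<subseteq> \<D>" for F
        using fin[OF that] that DA by (auto simp: \<A>_def)
      ultimately show ?thesis
        using comp[unfolded compact_space_fip, rule_format, of \<D>] by simp
    qed
    moreover have "closedin T (\<Inter>\<D>)"
      using DA Dne by (intro closedin_Inter) (auto simp: \<A>_def)
    moreover have "\<Inter>\<D> \<subseteq> S" "\<forall>a\<in>\<Inter>\<D>. \<forall>b\<in>\<Inter>\<D>. m a b \<in> \<Inter>\<D>"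
      using DA Dne by (auto simp: \<A>_def)
    ultimately have "\<Inter>\<D> \<in> \<A>"
      by (simp add: \<A>_def)
    moreover have "\<Union>\<C> = - \<Inter>\<D>"
      by (auto simp: \<D>_def)
    ultimately show "\<Union>\<C> \<in> uminus ` \<A>"
      by blast
  qed
  then obtain A where A: "A \<in> \<A>" and max: "\<forall>X\<in>uminus ` \<A>. - A \<subseteq> X \<longrightarrow> X = - A"
    by (elim bexE imageE) simp
  have minimal: "B = A" if "B \<in> \<A>" "B \<subseteq> A" for B
    using max[rule_format, of "- B"] that by simp
  obtain a where a: "a \<in> A"
    using A by (auto simp: \<A>_def)
  have AS: "A \<subseteq> S" and Am: "\<And>x y. x \<in> A \<Longrightarrow> y \<in> A \<Longrightarrow> m x y \<in> A" and Ac: "closedin T A"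
    using A by (auto simp: \<A>_def)
  have conta: "continuous_map T T (\<lambda>x. m x a)"
    using cont a AS by blast
  have "(\<lambda>x. m x a) ` A = A"
  proof (rule minimal)
    have "closedin T ((\<lambda>x. m x a) ` A)"
      by (metis Ac comp conta closedin_compact_space compactin_imp_closedin haus image_compactin)
    moreover have "m (m x a) (m y a) \<in> (\<lambda>x. m x a) ` A" if "x \<in> A" "y \<in> A" for x y
    proof -
      have "m (m x a) (m y a) = m (m (m x a) y) a"
        using that a AS Am assoc by (metis subsetD)
      then show ?thesis
        using that a Am by blast
    qed
    ultimately show "(\<lambda>x. m x a) ` A \<in> \<A>"
      using a AS Am by (auto simp: \<A>_def)
    show "(\<lambda>x. m x a) ` A \<subseteq> A"
      using a Am by blast
  qed
  then obtain x where x: "x \<in> A" "m x a = a"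
    using a by (metis imageE)
  \<comment> \<open>Nonempty by the preceding step, and closed as the preimage of a point under the
    continuous map \<open>\<lambda>x. m x a\<close>.\<close>
  have "{x \<in> A. m x a = a} = A"
  proof (rule minimal)
    have "{x \<in> A. m x a = a} = A \<inter> {x \<in> topspace T. m x a \<in> {a}}"
      using closedin_subset[OF Ac] by auto
    moreover have "closedin T {a}"
      using haus a closedin_subset[OF Ac] by (auto intro: closedin_Hausdorff_singleton)
    ultimately have "closedin T {x \<in> A. m x a = a}"
      using closedin_continuous_map_preimage[OF conta] Ac by (metis closedin_Int)
    moreover have "m (m y z) a = a" if "y \<in> A" "z \<in> A" "m y a = a" "m z a = a" for y z
      using that assoc a AS by (metis subsetD)
    ultimately show "{x \<in> A. m x a = a} \<in> \<A>"
      using x AS Am by (auto simp: \<A>_def)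
  qed blast
  then have "m a a = a"
    using a by blast
  then show ?thesis
    using that a AS by blast
qed


section \<open>Absorbing coherent sequences\<close>

text \<open>An abstraction of the cofinal ultrafilters: \<open>K i\<close> is the layer of index
  \<open>i\<close>, and \<open>H\<close> pairs a continuous map \<open>h\<close>, additive on the
  layers, with the map \<open>g\<close> that tells where \<open>h\<close> sends the terms of a
  coherent sequence. Continuity of \<open>\<odot>\<close> is assumed in the left argument
  only.\<close>

locale layered_compact_semigroup =
  fixes T :: "'a topology"
    and mul :: "'a \<Rightarrow> 'a \<Rightarrow> 'a" (infixl "\<odot>" 70)
    and K :: "nat \<Rightarrow> 'a set"
    and H :: "(('a \<Rightarrow> 'a) \<times> (nat \<Rightarrow> nat)) set"
  assumes compact: "compact_space T" and Hausdorff: "Hausdorff_space T"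
    and topspace: "topspace T = UNIV"
    and closed: "closedin T (K i)"
    and mul_layer: "a \<in> K i \<Longrightarrow> b \<in> K j \<Longrightarrow> a \<odot> b \<in> K (max i j)"
    and assoc: "a \<in> K i \<Longrightarrow> b \<in> K j \<Longrightarrow> c \<in> K k \<Longrightarrow> a \<odot> b \<odot> c = a \<odot> (b \<odot> c)"
    and cont_mul: "b \<in> K j \<Longrightarrow> continuous_map T T (\<lambda>a. a \<odot> b)"
    and cont_hom: "(h, g) \<in> H \<Longrightarrow> continuous_map T T h"
    and hom: "(h, g) \<in> H \<Longrightarrow> a \<in> K i \<Longrightarrow> b \<in> K j \<Longrightarrow> h (a \<odot> b) = h a \<odot> h b"
    and shift_0: "(h, g) \<in> H \<Longrightarrow> g 0 = 0"
    and shift_Suc: "(h, g) \<in> H \<Longrightarrow> g (Suc i) = g i \<or> g (Suc i) = Suc (g i)"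
begin

text \<open>The index \<open>g i\<close> is prescribed, not existentially quantified, so that
  pointwise products of coherent sequences are coherent.\<close>

definition coherent :: "(nat \<Rightarrow> 'a) \<Rightarrow> bool" where
  "coherent u \<longleftrightarrow> (\<forall>i. u i \<in> K i) \<and> (\<forall>(h, g)\<in>H. \<forall>i. h (u i) = u (g i))"

lemma coherent_layer: "coherent u \<Longrightarrow> u i \<in> K i"
  and coherent_hom: "coherent u \<Longrightarrow> (h, g) \<in> H \<Longrightarrow> h (u i) = u (g i)"
  by (auto simp: coherent_def)

lemma coherentI:
  assumes "\<And>i. u i \<in> K i" "\<And>h g i. (h, g) \<in> H \<Longrightarrow> h (u i) = u (g i)"
  shows "coherent u"
  using assms by (auto simp: coherent_def)

lemma shift_le: "(h, g) \<in> H \<Longrightarrow> g i \<le> i"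
proof (induction i)
  case (Suc i)
  then show ?case using shift_Suc[of h g i] by auto
qed (simp add: shift_0)

text \<open>The invariant after \<open>k\<close> steps of the construction. The case
  \<open>j = i\<close> makes the first \<open>k\<close> terms idempotent.\<close>

definition absorbs :: "nat \<Rightarrow> (nat \<Rightarrow> 'a) \<Rightarrow> bool" where
  "absorbs k u \<longleftrightarrow> (\<forall>i<k. \<forall>j\<ge>i. u j \<odot> u i = u j)"

text \<open>Ellis' lemma is applied, in the product space, to the coherent sequences that agree with
  \<open>v\<close> below \<open>k\<close> and absorb these terms on the right. The sequence
  \<open>v\<close> is one of them.\<close>

lemma idempotent_coherent:
  assumes v: "coherent v" "absorbs k v"
  obtains x where "coherent x" "\<And>i. x i \<odot> x i = x i" "\<And>i. i < k \<Longrightarrow> x i = v i"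
    "\<And>i j. i < k \<Longrightarrow> i \<le> j \<Longrightarrow> x j \<odot> v i = x j"
proof -
  let ?P = "product_topology (\<lambda>_::nat. T) UNIV"
  \<comment> \<open>The absorbed factor is the fixed \<open>v i\<close>, not \<open>x i\<close>:
    continuity in the left argument then suffices for \<open>Z\<close> to be closed.\<close>
  define Z where "Z = {x. coherent x \<and> (\<forall>i<k. x i = v i) \<and> (\<forall>i<k. \<forall>j\<ge>i. x j \<odot> v i = x j)}"
  have top: "topspace ?P = UNIV"
    by (simp add: topspace)
  have proj: "continuous_map ?P T (\<lambda>x. x i)" for i
    by (rule continuous_map_product_projection) simp
  have eqn: "closedin ?P {x. f x = g x}" if "continuous_map ?P T f" "continuous_map ?P T g" for f g
    using closedin_continuous_maps_eq[OF Hausdorff that] top by simp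
  have const: "continuous_map ?P T (\<lambda>_. c)" for c
    by (simp add: topspace)
  have mulr: "continuous_map ?P T (\<lambda>x. x j \<odot> b)" if "b \<in> K i" for i j b
    using continuous_map_compose[OF proj cont_mul[OF that]] by (simp add: o_def)
  have homc: "continuous_map ?P T (\<lambda>x. h (x j))" if "(h, g) \<in> H" for h g j
    using continuous_map_compose[OF proj cont_hom[OF that]] by (simp add: o_def)
  define \<C> where "\<C> = range (\<lambda>i. {x. x i \<in> K i}) \<union> {{x. h (x i) = x (g i)} | h g i. (h, g) \<in> H}
    \<union> {{x. x i = v i} | i. i < k} \<union> {{x. x j \<odot> v i = x j} | i j. i < k \<and> i \<le> j}"
  have "closedin ?P C" if "C \<in> \<C>" for C
  proof -
    have "closedin ?P {x. x i \<in> K i}" for i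
      using closedin_continuous_map_preimage[OF proj closed] top by simp
    moreover have "closedin ?P {x. x j \<odot> v i = x j}" for i j
      by (rule eqn[OF mulr[OF coherent_layer[OF v(1)]] proj])
    ultimately show ?thesis
      using that by (auto simp: \<C>_def intro: eqn proj const homc)
  qed
  then have "closedin ?P (\<Inter>\<C>)"
    by (intro closedin_Inter) (auto simp: \<C>_def)
  moreover have "\<Inter>\<C> = Z"
  proof (intro subset_antisym subsetI)
    fix x assume x: "x \<in> \<Inter>\<C>"
    have "x i \<in> K i" for i
      using x by (auto simp: \<C>_def)
    moreover have "h (x i) = x (g i)" if "(h, g) \<in> H" for h g i
    proof -
      have "{x. h (x i) = x (g i)} \<in> \<C>"
        using that unfolding \<C>_def by blast
      then show ?thesis using x by blast
    qed
    moreover have "x i = v i" if "i < k" for i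
    proof -
      have "{x. x i = v i} \<in> \<C>"
        using that unfolding \<C>_def by blast
      then show ?thesis using x by blast
    qed
    moreover have "x j \<odot> v i = x j" if "i < k" "i \<le> j" for i j
    proof -
      have "{x. x j \<odot> v i = x j} \<in> \<C>"
        using that unfolding \<C>_def by blast
      then show ?thesis using x by blast
    qed
    ultimately show "x \<in> Z"
      by (simp add: Z_def coherentI)
  next
    fix x assume "x \<in> Z"
    then show "x \<in> \<Inter>\<C>"
      by (auto simp: \<C>_def Z_def coherent_def)
  qed
  ultimately have Zc: "closedin ?P Z" by simp
  have comp: "compact_space ?P" and haus: "Hausdorff_space ?P"
    by (simp_all add: compact_space_product_topology Hausdorff_space_product_topology compact Hausdorff)
  have ZK: "x i \<in> K i" if "x \<in> Z" for x i
    using that by (simp add: Z_def coherent_layer)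
  obtain x where "x \<in> Z" "(\<lambda>i. x i \<odot> x i) = x"
  proof (rule ellis_idempotent[OF comp haus Zc, where m = "\<lambda>x y i. x i \<odot> y i"])
    show "Z \<noteq> {}"
      using v by (auto simp: Z_def absorbs_def)
    show "(\<lambda>i. x i \<odot> y i) \<in> Z" if "x \<in> Z" "y \<in> Z" for x y
    proof -
      have "coherent (\<lambda>i. x i \<odot> y i)"
      proof (rule coherentI)
        show "x i \<odot> y i \<in> K i" for i
          using mul_layer[OF ZK ZK] that by (metis max.idem)
        show "h (x i \<odot> y i) = x (g i) \<odot> y (g i)" if "(h, g) \<in> H" for h g i
          using hom[OF that ZK ZK] coherent_hom[OF _ that] \<open>x \<in> Z\<close> \<open>y \<in> Z\<close> by (simp add: Z_def)
      qed
      moreover have "x j \<odot> y j \<odot> v i = x j \<odot> y j" if "i < k" "i \<le> j" for i j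
        using that \<open>x \<in> Z\<close> \<open>y \<in> Z\<close> assoc[OF ZK[of x j] ZK[of y j] coherent_layer[OF v(1), of i]]
        by (auto simp: Z_def)
      \<comment> \<open>For \<open>i < k\<close> both factors are \<open>v i\<close>, which is
        idempotent, so the product still agrees with \<open>v\<close> there.\<close>
      ultimately show ?thesis
        using that v by (auto simp: Z_def absorbs_def)
    qed
    show "(\<lambda>i. x i \<odot> y i \<odot> z i) = (\<lambda>i. x i \<odot> (y i \<odot> z i))" if "x \<in> Z" "y \<in> Z" "z \<in> Z" for x y z
      using that by (auto intro!: assoc ZK)
    show "continuous_map ?P ?P (\<lambda>x i. x i \<odot> y i)" if "y \<in> Z" for y
      using mulr[OF ZK[OF that]] by (simp add: continuous_map_componentwise_UNIV)
  qed
  then show ?thesis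
    by (intro that[of x]) (auto simp: Z_def fun_eq_iff)
qed

text \<open>With \<open>x\<close> idempotent, the products
  \<open>w j = x j \<odot> \<dots> \<odot> x k\<close> for \<open>j \<ge> k\<close> absorb
  \<open>x k\<close> on the right, and the terms below \<open>k\<close> are kept. A map in
  \<open>H\<close> turns such a product into one with repeated factors, which collapse.\<close>

lemma absorbs_step:
  assumes v: "coherent v" "absorbs k v"
  obtains w where "coherent w" "absorbs (Suc k) w" "\<And>i. i < k \<Longrightarrow> w i = v i"
proof -
  obtain x where x: "coherent x" and idem: "\<And>i. x i \<odot> x i = x i"
    and xv: "\<And>i. i < k \<Longrightarrow> x i = v i" and abs_v: "\<And>i j. i < k \<Longrightarrow> i \<le> j \<Longrightarrow> x j \<odot> v i = x j"
    by (rule idempotent_coherent[OF v]) blast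
  have abs_x: "x j \<odot> x i = x j" if "i < k" "i \<le> j" for i j
    using that abs_v xv by simp
  define w where "w = rec_nat (x 0) (\<lambda>j y. if Suc j \<le> k then x (Suc j) else x (Suc j) \<odot> y)"
  have w_0: "w 0 = x 0" and w_Suc: "w (Suc j) = (if Suc j \<le> k then x (Suc j) else x (Suc j) \<odot> w j)" for j
    by (simp_all add: w_def)
  note xK = coherent_layer[OF x]
  have w_le: "w i = x i" if "i \<le> k" for i
    using that by (cases i) (simp_all add: w_0 w_Suc)
  have wK: "w i \<in> K i" for i
  proof (induction i)
    case (Suc i)
    then show ?case
      using mul_layer[OF xK[of "Suc i"] Suc] xK[of "Suc i"] by (auto simp: w_Suc max_def)
  qed (simp add: w_0 xK)
  \<comment> \<open>\<open>down\<close> and \<open>same\<close> serve the cases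
    \<open>g (Suc i) = Suc (g i)\<close> and \<open>g (Suc i) = g i\<close> of coherence. For
    \<open>m < k\<close> the factor \<open>w m = x m\<close> is absorbed by
    \<open>x (Suc m)\<close>.\<close>
  have down: "x (Suc m) \<odot> w m = w (Suc m)" for m
    using abs_x[of m "Suc m"] by (auto simp: w_Suc w_le)
  have same: "x m \<odot> w m = w m" for m
  proof (cases m)
    case (Suc n)
    then show ?thesis
      using assoc[OF xK[of m] xK[of m] wK[of n]] by (simp add: w_Suc idem)
  qed (simp add: w_0 idem)
  have "coherent w"
  proof (rule coherentI[OF wK])
    fix h g i
    assume H: "(h, g) \<in> H"
    show "h (w i) = w (g i)"
    proof (induction i)
      case 0
      then show ?case
        using coherent_hom[OF x H, of 0] by (simp add: w_0 shift_0[OF H])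
    next
      case (Suc i)
      show ?case
      proof (cases "Suc i \<le> k")
        case True
        then show ?thesis
          using coherent_hom[OF x H, of "Suc i"] shift_le[OF H, of "Suc i"] by (simp add: w_le)
      next
        case False
        then have "h (w (Suc i)) = x (g (Suc i)) \<odot> w (g i)"
          using hom[OF H xK wK] coherent_hom[OF x H] Suc by (simp add: w_Suc)
        then show ?thesis
          using shift_Suc[OF H, of i] same down by auto
      qed
    qed
  qed
  moreover have "w j \<odot> w i = w j" if "i \<le> k" "i \<le> j" for i j
    using \<open>i \<le> j\<close>
  proof (induction rule: dec_induct)
    case base
    then show ?case using that idem by (simp add: w_le)
  next
    case (step n)
    show ?case
    proof (cases "Suc n \<le> k")
      case True
      then show ?thesis using abs_x step by (simp add: w_le)
    next
      case False
      then show ?thesis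
        using assoc[OF xK[of "Suc n"] wK[of n] wK[of i]] step by (simp add: w_Suc)
    qed
  qed
  ultimately show ?thesis
    by (intro that[of w]) (auto simp: absorbs_def less_Suc_eq_le w_le xv)
qed

text \<open>Dependent choice iterates the step, and every term is eventually constant. Each
  condition involves finitely many indices, as \<open>g i \<le> i\<close>, and so survives in the
  limit.\<close>

lemma coherent_right_absorbing:
  assumes "coherent u0"
  obtains u where "coherent u" "\<And>i j. i \<le> j \<Longrightarrow> u j \<odot> u i = u j"
proof -
  have "\<exists>f. \<forall>n. (coherent (f n) \<and> absorbs n (f n)) \<and> (\<forall>i<n. f (Suc n) i = f n i)"
  proof (rule dependent_nat_choice)
    show "\<exists>x. coherent x \<and> absorbs 0 x"
      using assms by (auto simp: absorbs_def)
    show "\<exists>y. (coherent y \<and> absorbs (Suc n) y) \<and> (\<forall>i<n. y i = x i)"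
      if "coherent x \<and> absorbs n x" for x n
      using that absorbs_step[of x n] by metis
  qed
  then obtain f where f: "\<And>n. coherent (f n)" "\<And>n. absorbs n (f n)"
    "\<And>n i. i < n \<Longrightarrow> f (Suc n) i = f n i"
    by blast
  \<comment> \<open>Stage \<open>Suc i\<close> is the first from which the term of index
    \<open>i\<close> no longer changes.\<close>
  define u where "u i = f (Suc i) i" for i
  have fu: "f n i = u i" if "i < n" for n i
    using that
  proof (induction n)
    case (Suc n)
    then show ?case by (cases "i = n") (auto simp: u_def f(3))
  qed simp
  have "coherent u"
  proof (rule coherentI)
    show "u i \<in> K i" for i
      by (simp add: u_def coherent_layer f)
    show "h (u i) = u (g i)" if "(h, g) \<in> H" for h g i
      using coherent_hom[OF f(1) that, of "Suc i" i] shift_le[OF that, of i] by (simp add: fu)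
  qed
  moreover have "u j \<odot> u i = u j" if "i \<le> j" for i j
  proof -
    have "f (Suc j) j \<odot> f (Suc j) i = f (Suc j) j"
      using f(2)[of "Suc j", unfolded absorbs_def, rule_format, of i j] that by simp
    then show ?thesis
      using that by (simp add: fu)
  qed
  ultimately show ?thesis
    by (rule that)
qed

text \<open>Take \<open>v j = u 0 \<odot> \<dots> \<odot> u j\<close>. The last factor
  \<open>u j\<close> absorbs all of \<open>v i\<close> on the right for \<open>i \<le> j\<close>; in
  particular \<open>v i\<close> is idempotent, and as \<open>v j\<close> begins with
  \<open>v i\<close>, absorption on the left follows.\<close>

theorem coherent_absorbing:
  assumes "coherent u0"
  obtains v where "coherent v" "\<And>i j. i \<le> j \<Longrightarrow> v j \<odot> v i = v j"
    "\<And>i j. i \<le> j \<Longrightarrow> v i \<odot> v j = v j"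
proof -
  obtain u where u: "coherent u" and absorb: "\<And>i j. i \<le> j \<Longrightarrow> u j \<odot> u i = u j"
    using coherent_right_absorbing[OF assms] by blast
  define v where "v = rec_nat (u 0) (\<lambda>j y. y \<odot> u (Suc j))"
  have v_0: "v 0 = u 0" and v_Suc: "v (Suc j) = v j \<odot> u (Suc j)" for j
    by (simp_all add: v_def)
  note uK = coherent_layer[OF u]
  have vK: "v i \<in> K i" for i
  proof (induction i)
    case (Suc i)
    then show ?case
      using mul_layer[OF Suc uK[of "Suc i"]] by (auto simp: v_Suc max_def)
  qed (simp add: v_0 uK)
  \<comment> \<open>Collapses the repeated factor that \<open>h\<close> produces when
    \<open>g (Suc i) = g i\<close>.\<close>
  have same: "v m \<odot> u m = v m" for m
  proof (cases m)
    case (Suc n)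
    then show ?thesis
      using assoc[OF vK[of n] uK[of m] uK[of m]] by (simp add: v_Suc absorb)
  qed (simp add: v_0 absorb)
  have "coherent v"
  proof (rule coherentI[OF vK])
    fix h g i
    assume H: "(h, g) \<in> H"
    show "h (v i) = v (g i)"
    proof (induction i)
      case 0
      then show ?case
        using coherent_hom[OF u H, of 0] by (simp add: v_0 shift_0[OF H])
    next
      case (Suc i)
      then have "h (v (Suc i)) = v (g i) \<odot> u (g (Suc i))"
        using hom[OF H vK uK] coherent_hom[OF u H] by (simp add: v_Suc)
      then show ?case
        using shift_Suc[OF H, of i] same by (auto simp: v_Suc)
    qed
  qed
  moreover have uv: "u j \<odot> v i = u j" if "i \<le> j" for i j
    using that
  proof (induction i)
    case (Suc i)
    then show ?case
      using assoc[OF uK[of j] vK[of i] uK[of "Suc i"]] by (simp add: v_Suc absorb)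
  qed (simp add: v_0 absorb)
  have vv: "v j \<odot> v i = v j" if "i \<le> j" for i j
  proof (cases j)
    case (Suc n)
    then show ?thesis
      using assoc[OF vK[of n] uK[of j] vK[of i]] uv[OF that] by (simp add: v_Suc)
  qed (use that absorb in \<open>simp add: v_0\<close>)
  moreover have "v i \<odot> v j = v j" if "i \<le> j" for i j
    using that
  proof (induction rule: dec_induct)
    case base
    then show ?case by (simp add: vv)
  next
    case (step n)
    then show ?case
      using assoc[OF vK[of i] vK[of n] uK[of "Suc n"]] by (simp add: v_Suc)
  qed
  ultimately show ?thesis
    by (intro that)
qed

end


section \<open>Sums of ultrafilters\<close>

text \<open>Ultrafilters are predicates on all sets of the type; an ultrafilter on \<open>S\<close> is one that holds of \<open>S\<close>.\<close>

definition ultrafil :: "('a set \<Rightarrow> bool) \<Rightarrow> bool" where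
  "ultrafil u \<longleftrightarrow> (\<forall>A B. u (A \<inter> B) \<longleftrightarrow> u A \<and> u B) \<and> (\<forall>A. u (- A) \<longleftrightarrow> \<not> u A)"

lemma ultrafil_Int: "ultrafil u \<Longrightarrow> u (A \<inter> B) \<longleftrightarrow> u A \<and> u B"
  and ultrafil_Compl: "ultrafil u \<Longrightarrow> u (- A) \<longleftrightarrow> \<not> u A"
  by (auto simp: ultrafil_def)

lemma ultrafil_mono: "ultrafil u \<Longrightarrow> u A \<Longrightarrow> A \<subseteq> B \<Longrightarrow> u B"
  using ultrafil_Int[of u A B] by (simp add: inf_absorb1)

lemma ultrafil_nonempty: "ultrafil u \<Longrightarrow> u A \<Longrightarrow> A \<noteq> {}"
  using ultrafil_mono[of u "{}" UNIV] ultrafil_Compl[of u UNIV] by auto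

text \<open>Reduces computations with ultrafilters to a large set of points, usually those where a
  sum is defined.\<close>

lemma ultrafil_cong:
  assumes "ultrafil u" "u A" "\<And>x. x \<in> A \<Longrightarrow> x \<in> B \<longleftrightarrow> x \<in> C"
  shows "u B \<longleftrightarrow> u C"
proof -
  have "B \<inter> A = C \<inter> A"
    using assms(3) by blast
  then show ?thesis
    by (metis assms(1,2) ultrafil_Int)
qed

text \<open>An undefined sum counts as lying outside \<open>B\<close>. The order of the quantifiers
  is that of \<open>\<alpha> + \<^sup>*\<beta>\<close>, with \<open>u\<close> and \<open>v\<close>
  the types of \<open>\<alpha>\<close> and \<open>\<beta>\<close>.\<close>

definition usum :: "('a \<Rightarrow> 'a \<Rightarrow> 'a option) \<Rightarrow> ('a set \<Rightarrow> bool) \<Rightarrow> ('a set \<Rightarrow> bool) \<Rightarrow> 'a set \<Rightarrow> bool" where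
  "usum p u v B \<longleftrightarrow> u {x. v {y. \<exists>z\<in>B. p x y = Some z}}"

definition upush :: "('a \<Rightarrow> 'a) \<Rightarrow> ('a set \<Rightarrow> bool) \<Rightarrow> 'a set \<Rightarrow> bool" where
  "upush f u B \<longleftrightarrow> u (f -` B)"

text \<open>The ultrafilters generated by the points of \<open>gam U L (layer L i)\<close>. As
  \<open>x\<close> ranges over the whole carrier, ultrafilters of different layers can be
  added.\<close>

definition cofinal_layer :: "('a, 'z) layered_scheme \<Rightarrow> nat \<Rightarrow> ('a set \<Rightarrow> bool) set" where
  "cofinal_layer L i =
     {u. ultrafil u \<and> u (layer L i) \<and> (\<forall>x\<in>carr L. u {y. psum L x y \<noteq> None})}"

lemma cofinal_layerD:
  assumes "u \<in> cofinal_layer L i"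
  shows "ultrafil u" "u (layer L i)" "u (carr L)" "\<And>x. x \<in> carr L \<Longrightarrow> u {y. psum L x y \<noteq> None}"
proof -
  show u: "ultrafil u" and "u (layer L i)" and "\<And>x. x \<in> carr L \<Longrightarrow> u {y. psum L x y \<noteq> None}"
    using assms unfolding cofinal_layer_def by blast+
  then show "u (carr L)"
    using ultrafil_mono[of u "layer L i" "carr L"] by (auto simp: layer_def)
qed

text \<open>Complements need care: for \<open>x\<close> in the \<open>u\<close>-large set
  \<open>S\<close> the sum \<open>p x y\<close> is defined for \<open>v\<close>-many
  \<open>y\<close>, and for these missing \<open>A\<close> means landing in
  \<open>- A\<close>.\<close>

lemma ultrafil_usum:
  assumes u: "ultrafil u" "u S" and v: "ultrafil v" "\<And>x. x \<in> S \<Longrightarrow> v {y. p x y \<noteq> None}"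
  shows "ultrafil (usum p u v)"
proof -
  have "{y. \<exists>z\<in>A \<inter> B. p x y = Some z} = {y. \<exists>z\<in>A. p x y = Some z} \<inter> {y. \<exists>z\<in>B. p x y = Some z}"
    for A B x by force
  then have "usum p u v (A \<inter> B) \<longleftrightarrow> usum p u v A \<and> usum p u v B" for A B
    by (simp add: usum_def ultrafil_Int[OF u(1), symmetric] ultrafil_Int[OF v(1)] Collect_conj_eq)
  moreover have "usum p u v (- A) \<longleftrightarrow> \<not> usum p u v A" for A
  proof -
    have "v {y. \<exists>z\<in>- A. p x y = Some z} \<longleftrightarrow> v (- {y. \<exists>z\<in>A. p x y = Some z})" if "x \<in> S" for x
      by (rule ultrafil_cong[OF v(1) v(2)[OF that]]) auto
    then have "u {x. v {y. \<exists>z\<in>- A. p x y = Some z}} \<longleftrightarrow> u (- {x. v {y. \<exists>z\<in>A. p x y = Some z}})"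
      by (intro ultrafil_cong[OF u]) (simp add: ultrafil_Compl[OF v(1)])
    then show ?thesis
      by (simp add: usum_def ultrafil_Compl[OF u(1)])
  qed
  ultimately show ?thesis
    by (simp add: ultrafil_def)
qed

section \<open>Closure, associativity and images of sums of cofinal ultrafilters\<close>

lemma partial_semigroup_closed:
  "partial_semigroup L \<Longrightarrow> x \<in> carr L \<Longrightarrow> y \<in> carr L \<Longrightarrow> psum L x y = Some z \<Longrightarrow> z \<in> carr L"
  unfolding partial_semigroup_def by blast

lemma partial_semigroup_assoc:
  assumes "partial_semigroup L" "x \<in> carr L" "y \<in> carr L" "z \<in> carr L"
    "psum L x y = Some a" "psum L y z = Some b"
  shows "psum L a z = psum L x b"
proof -
  have "Option.bind (psum L x y) (\<lambda>u. psum L u z) = Option.bind (psum L y z) (\<lambda>v. psum L x v)"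
    using assms(1-4) unfolding partial_semigroup_def by blast
  then show ?thesis
    using assms(5,6) by simp
qed

text \<open>For cofinality, \<open>w + (x + y)\<close> is rewritten as \<open>(w + x) + y\<close>,
  which is defined for \<open>v\<close>-many \<open>y\<close> once \<open>w + x\<close> is
  defined.\<close>

lemma usum_layer:
  assumes L: "adequate_partial_layered_semigroup L \<delta>"
    and u: "u \<in> cofinal_layer L i" and v: "v \<in> cofinal_layer L j"
  shows "usum (psum L) u v \<in> cofinal_layer L (max i j)"
proof -
  note u' = cofinal_layerD[OF u] and v' = cofinal_layerD[OF v]
  have ps: "partial_semigroup L" and lay: "\<And>s t z. s \<in> carr L \<Longrightarrow> t \<in> carr L \<Longrightarrow> psum L s t = Some z \<Longrightarrow>
      lay L z = max (lay L s) (lay L t)"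
    using L unfolding adequate_partial_layered_semigroup_def by blast+
  have "ultrafil (usum (psum L) u v)"
    by (rule ultrafil_usum[OF u'(1,3) v'(1,4)])
  moreover have "usum (psum L) u v (layer L (max i j))"
    unfolding usum_def
  proof (rule ultrafil_mono[OF u'(1,2)], rule subsetI, rule CollectI)
    fix x assume x: "x \<in> layer L i"
    then have "v (layer L j \<inter> {y. psum L x y \<noteq> None})"
      using v'(2,4) by (simp add: ultrafil_Int[OF v'(1)] layer_def)
    then show "v {y. \<exists>z\<in>layer L (max i j). psum L x y = Some z}"
    proof (rule ultrafil_mono[OF v'(1)], intro subsetI CollectI)
      fix y assume "y \<in> layer L j \<inter> {y. psum L x y \<noteq> None}"
      then obtain z where y: "y \<in> layer L j" and z: "psum L x y = Some z"
        by blast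
      have "z \<in> layer L (max i j)"
        using x y z lay[of x y z] partial_semigroup_closed[OF ps, of x y z] by (simp add: layer_def)
      then show "\<exists>z\<in>layer L (max i j). psum L x y = Some z"
        using z by blast
    qed
  qed
  moreover have "usum (psum L) u v {y. psum L w y \<noteq> None}" if w: "w \<in> carr L" for w
  proof -
    have "u (carr L \<inter> {y. psum L w y \<noteq> None})"
      using u' w by (simp add: ultrafil_Int)
    then show ?thesis
      unfolding usum_def
    proof (rule ultrafil_mono[OF u'(1)], intro subsetI CollectI)
      fix x assume "x \<in> carr L \<inter> {y. psum L w y \<noteq> None}"
      then obtain t where x: "x \<in> carr L" and t: "psum L w x = Some t"
        by blast
      have "v (carr L \<inter> {y. psum L x y \<noteq> None} \<inter> {y. psum L t y \<noteq> None})"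
        using v' x partial_semigroup_closed[OF ps w x t] by (simp add: ultrafil_Int)
      then show "v {y. \<exists>z\<in>{y. psum L w y \<noteq> None}. psum L x y = Some z}"
      proof (rule ultrafil_mono[OF v'(1)], intro subsetI CollectI)
        fix y assume "y \<in> carr L \<inter> {y. psum L x y \<noteq> None} \<inter> {y. psum L t y \<noteq> None}"
        then obtain z where "y \<in> carr L" "psum L t y \<noteq> None" "psum L x y = Some z"
          by blast
        then show "\<exists>z\<in>{y. psum L w y \<noteq> None}. psum L x y = Some z"
          using partial_semigroup_assoc[OF ps w x _ t, of y z] by simp
      qed
    qed
  qed
  ultimately show ?thesis
    by (simp add: cofinal_layer_def)
qed

text \<open>The quantifiers over \<open>u\<close>, \<open>v\<close> and \<open>w\<close> are peeled
  off in turn, each restricted to points with defined sums, until partial associativity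
  applies.\<close>

lemma usum_assoc:
  assumes L: "partial_semigroup L"
    and u: "u \<in> cofinal_layer L i" and v: "v \<in> cofinal_layer L j" and w: "w \<in> cofinal_layer L k"
  shows "usum (psum L) (usum (psum L) u v) w = usum (psum L) u (usum (psum L) v w)"
proof
  fix B
  note u' = cofinal_layerD[OF u] and v' = cofinal_layerD[OF v] and w' = cofinal_layerD[OF w]
  show "usum (psum L) (usum (psum L) u v) w B = usum (psum L) u (usum (psum L) v w) B"
    unfolding usum_def
  proof (rule ultrafil_cong[OF u'(1,3)], unfold mem_Collect_eq)
    fix x assume x: "x \<in> carr L"
    have "v (carr L \<inter> {y. psum L x y \<noteq> None})"
      using v' x by (simp add: ultrafil_Int)
    then show "v {y. \<exists>z\<in>{a. w {c. \<exists>d\<in>B. psum L a c = Some d}}. psum L x y = Some z} \<longleftrightarrow>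
      v {y. w {c. \<exists>z\<in>{b. \<exists>d\<in>B. psum L x b = Some d}. psum L y c = Some z}}"
    proof (rule ultrafil_cong[OF v'(1)], unfold mem_Collect_eq)
      fix y assume "y \<in> carr L \<inter> {y. psum L x y \<noteq> None}"
      then obtain a where y: "y \<in> carr L" and a: "psum L x y = Some a"
        by blast
      have "w (carr L \<inter> {c. psum L y c \<noteq> None})"
        using w' y by (simp add: ultrafil_Int)
      then have "w {c. \<exists>d\<in>B. psum L a c = Some d} \<longleftrightarrow>
        w {c. \<exists>z\<in>{b. \<exists>d\<in>B. psum L x b = Some d}. psum L y c = Some z}"
      proof (rule ultrafil_cong[OF w'(1)])
        fix c assume "c \<in> carr L \<inter> {c. psum L y c \<noteq> None}"
        then obtain b where "c \<in> carr L" "psum L y c = Some b"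
          by blast
        then show "c \<in> {c. \<exists>d\<in>B. psum L a c = Some d} \<longleftrightarrow>
          c \<in> {c. \<exists>z\<in>{b. \<exists>d\<in>B. psum L x b = Some d}. psum L y c = Some z}"
          using partial_semigroup_assoc[OF L x y _ a, of c b] by simp
      qed
      then show "(\<exists>z\<in>{a. w {c. \<exists>d\<in>B. psum L a c = Some d}}. psum L x y = Some z) \<longleftrightarrow>
        w {c. \<exists>z\<in>{b. \<exists>d\<in>B. psum L x b = Some d}. psum L y c = Some z}"
        using a by simp
    qed
  qed
qed

lemma upush_usum:
  assumes u: "u \<in> cofinal_layer L i" and v: "v \<in> cofinal_layer L j"
    and f: "\<And>s t z. s \<in> carr L \<Longrightarrow> t \<in> carr L \<Longrightarrow> psum L s t = Some z \<Longrightarrow>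
      psum L (f s) (f t) = Some (f z)"
  shows "upush f (usum (psum L) u v) = usum (psum L) (upush f u) (upush f v)"
proof
  fix B
  note u' = cofinal_layerD[OF u] and v' = cofinal_layerD[OF v]
  show "upush f (usum (psum L) u v) B = usum (psum L) (upush f u) (upush f v) B"
    unfolding usum_def upush_def vimage_Collect_eq
  proof (rule ultrafil_cong[OF u'(1,3)], unfold mem_Collect_eq)
    fix x assume x: "x \<in> carr L"
    have "v (carr L \<inter> {y. psum L x y \<noteq> None})"
      using v' x by (simp add: ultrafil_Int)
    then show "v {y. \<exists>z\<in>f -` B. psum L x y = Some z} \<longleftrightarrow> v {y. \<exists>z\<in>B. psum L (f x) (f y) = Some z}"
    proof (rule ultrafil_cong[OF v'(1)])
      fix y assume "y \<in> carr L \<inter> {y. psum L x y \<noteq> None}"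
      then obtain z where "y \<in> carr L" "psum L x y = Some z"
        by blast
      then show "y \<in> {y. \<exists>z\<in>f -` B. psum L x y = Some z} \<longleftrightarrow> y \<in> {y. \<exists>z\<in>B. psum L (f x) (f y) = Some z}"
        using f[OF x, of y z] by simp
    qed
  qed
qed

section \<open>Compactness and continuity for pointwise convergence\<close>

text \<open>The Cantor cube of all predicates on sets, compact by Tychonoff; it induces the Stone
  topology on ultrafilters.\<close>

definition pointwise_topology :: "('a set \<Rightarrow> bool) topology" where
  "pointwise_topology = product_topology (\<lambda>_. discrete_topology UNIV) UNIV"

lemma topspace_pointwise: "topspace pointwise_topology = UNIV"
  by (simp add: pointwise_topology_def)

lemma compact_pointwise: "compact_space pointwise_topology"
  by (simp add: pointwise_topology_def compact_space_product_topology compact_space_discrete_topology)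

lemma Hausdorff_pointwise: "Hausdorff_space pointwise_topology"
  by (simp add: pointwise_topology_def Hausdorff_space_product_topology)

lemma continuous_eval: "continuous_map pointwise_topology (discrete_topology UNIV) (\<lambda>u. u A)"
  unfolding pointwise_topology_def
  by (rule continuous_map_product_projection[where X = "\<lambda>_. discrete_topology UNIV"]) simp

text \<open>For fixed \<open>v\<close> and \<open>B\<close>, \<open>usum p u v B\<close> is the
  value of \<open>u\<close> at one fixed set, hence a coordinate of \<open>u\<close>.\<close>

lemma continuous_usum: "continuous_map pointwise_topology pointwise_topology (\<lambda>u. usum p u v)"
  by (subst (2) pointwise_topology_def)
    (auto simp: continuous_map_componentwise_UNIV usum_def intro: continuous_eval)

lemma continuous_upush: "continuous_map pointwise_topology pointwise_topology (upush f)"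
  by (subst (2) pointwise_topology_def)
    (auto simp: continuous_map_componentwise_UNIV upush_def intro: continuous_eval)

text \<open>Every clause of the definition, for fixed sets, restricts finitely many coordinates and
  so cuts out a closed set.\<close>

lemma closedin_cofinal_layer: "closedin pointwise_topology (cofinal_layer L i)"
proof -
  have clopen: "closedin pointwise_topology {u. u A = b}" for A :: "'a set" and b
  proof -
    have "closedin pointwise_topology {u \<in> topspace pointwise_topology. u A \<in> {b}}"
      by (rule closedin_continuous_map_preimage[OF continuous_eval]) simp
    then show ?thesis
      by (simp add: topspace_pointwise)
  qed
  note pos = clopen[where b = True, simplified] and neg = clopen[where b = False, simplified]
  have "{u. u (A \<inter> B) \<longleftrightarrow> u A \<and> u B} =
    {u. u (A \<inter> B)} \<inter> {u. u A} \<inter> {u. u B} \<union> {u. \<not> u (A \<inter> B)} \<inter> ({u. \<not> u A} \<union> {u. \<not> u B})"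
    for A B :: "'a set" by auto
  then have Int: "closedin pointwise_topology {u. u (A \<inter> B) \<longleftrightarrow> u A \<and> u B}" for A B :: "'a set"
    by (simp add: pos neg closedin_Int closedin_Un)
  have "{u. u (- A) \<longleftrightarrow> \<not> u A} = {u. u (- A)} \<inter> {u. \<not> u A} \<union> {u. \<not> u (- A)} \<inter> {u. u A}"
    for A :: "'a set" by auto
  then have Compl: "closedin pointwise_topology {u. u (- A) \<longleftrightarrow> \<not> u A}" for A :: "'a set"
    by (simp add: pos neg closedin_Int closedin_Un)
  \<comment> \<open>Inserting \<open>undefined\<close> keeps the index set nonempty, as closedness
    of an intersection demands; the guard \<open>x \<in> carr L\<close> makes this index
    harmless.\<close>
  have "cofinal_layer L i = (\<Inter>A. \<Inter>B. {u. u (A \<inter> B) \<longleftrightarrow> u A \<and> u B}) \<inter> (\<Inter>A. {u. u (- A) \<longleftrightarrow> \<not> u A}) \<inter>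
    {u. u (layer L i)} \<inter> (\<Inter>x\<in>insert undefined (carr L). {u. x \<in> carr L \<longrightarrow> u {y. psum L x y \<noteq> None}})"
    by (auto simp: cofinal_layer_def ultrafil_def)
  also have "closedin pointwise_topology \<dots>"
  proof -
    have "closedin pointwise_topology {u. x \<in> carr L \<longrightarrow> u {y. psum L x y \<noteq> None}}" for x
      using closedin_topspace[of pointwise_topology] by (cases "x \<in> carr L") (auto simp: topspace_pointwise intro: pos)
    then show ?thesis
      using Int Compl pos by (intro closedin_Int closedin_INT) auto
  qed
  finally show ?thesis .
qed


section \<open>Regressive maps\<close>

definition layer_shift :: "('a, 'z) layered_scheme \<Rightarrow> ('a \<Rightarrow> 'a) \<Rightarrow> nat \<Rightarrow> nat" where
  "layer_shift L f i = lay L (f (SOME s. s \<in> layer L i))"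

lemma layer_nonempty:
  assumes adequate: "adequate_partial_layered_semigroup L \<delta>" and i: "enat i < \<delta>"
  obtains s where "s \<in> layer L i"
proof -
  have "lay L ` carr L = {i. enat i < \<delta>}"
    using adequate unfolding adequate_partial_layered_semigroup_def by (elim conjE)
  then have "i \<in> lay L ` carr L"
    using i by simp
  then show ?thesis
    using that by (auto simp: layer_def)
qed

context
  fixes L :: "'a layered" and f :: "'a \<Rightarrow> 'a"
  assumes regressive: "regressive L f"
begin

lemma regressive_maps: "f \<in> carr L \<rightarrow> carr L"
  using regressive unfolding regressive_def by (elim conjE)

lemma regressive_le: "s \<in> carr L \<Longrightarrow> lay L (f s) \<le> lay L s"
  using regressive unfolding regressive_def by (elim conjE) (rule bspec)

lemma regressive_sum:
  "s \<in> carr L \<Longrightarrow> t \<in> carr L \<Longrightarrow> psum L s t = Some u \<Longrightarrow> psum L (f s) (f t) = Some (f u)"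
  using regressive unfolding regressive_def by blast

lemma regressive_mono:
  "s \<in> carr L \<Longrightarrow> t \<in> carr L \<Longrightarrow> lay L s \<le> lay L t \<Longrightarrow> lay L (f s) \<le> lay L (f t)"
  using regressive unfolding regressive_def by blast

lemma regressive_lipschitz:
  "s \<in> carr L \<Longrightarrow> t \<in> carr L \<Longrightarrow>
    \<bar>int (lay L (f s)) - int (lay L (f t))\<bar> \<le> \<bar>int (lay L s) - int (lay L t)\<bar>"
  using regressive unfolding regressive_def by blast

text \<open>Monotonicity, applied in both directions to \<open>s\<close> and the chosen
  representative.\<close>

lemma lay_regressive:
  assumes "s \<in> layer L i"
  shows "lay L (f s) = layer_shift L f i"
proof -
  have "(SOME s. s \<in> layer L i) \<in> layer L i"
    using assms by (rule someI)
  then show ?thesis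
    using assms regressive_mono[of s "SOME s. s \<in> layer L i"] regressive_mono[of "SOME s. s \<in> layer L i" s]
    unfolding layer_shift_def by (simp add: layer_def)
qed

lemma regressive_layer: "layer L i \<subseteq> f -` layer L (layer_shift L f i)"
  using lay_regressive regressive_maps by (auto simp: layer_def Pi_iff)

lemma layer_shift_le:
  assumes "adequate_partial_layered_semigroup L \<delta>" "enat i < \<delta>"
  shows "layer_shift L f i \<le> i"
proof -
  obtain s where s: "s \<in> layer L i"
    using layer_nonempty[OF assms] .
  then show ?thesis
    using regressive_le[of s] lay_regressive[OF s] by (simp add: layer_def)
qed

text \<open>For elements of adjacent layers, monotonicity orders the layers of the images and the
  Lipschitz condition bounds their difference by one.\<close>

lemma layer_shift_Suc:
  assumes "adequate_partial_layered_semigroup L \<delta>" "enat (Suc i) < \<delta>"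
  shows "layer_shift L f (Suc i) = layer_shift L f i \<or> layer_shift L f (Suc i) = Suc (layer_shift L f i)"
proof -
  have "enat i < \<delta>"
    using assms(2) by (meson enat_ord_simps(2) lessI less_trans)
  then obtain s where s: "s \<in> layer L i"
    using layer_nonempty[OF assms(1)] by blast
  obtain t where t: "t \<in> layer L (Suc i)"
    using layer_nonempty[OF assms] .
  then show ?thesis
    using regressive_mono[of s t] regressive_lipschitz[of t s] s lay_regressive[OF s] lay_regressive[OF t]
    by (simp add: layer_def) linarith
qed

end


section \<open>Transfer\<close>

definition FEx :: "nat \<Rightarrow> nat \<Rightarrow> bformula \<Rightarrow> bformula" where
  "FEx n i \<phi> = BNot (BAll n i (BNot \<phi>))"

definition FOr :: "bformula \<Rightarrow> bformula \<Rightarrow> bformula" where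
  "FOr \<phi> \<psi> = BNot (BAnd (BNot \<phi>) (BNot \<psi>))"

definition FIff :: "bformula \<Rightarrow> bformula \<Rightarrow> bformula" where
  "FIff \<phi> \<psi> = FOr (BAnd \<phi> \<psi>) (BAnd (BNot \<phi>) (BNot \<psi>))"

lemma bsat_FEx: "bsat M (FEx n i \<phi>) e \<longleftrightarrow> (\<exists>x. M x (e i) \<and> bsat M \<phi> (e(n := x)))"
  and bsat_FOr: "bsat M (FOr \<phi> \<psi>) e \<longleftrightarrow> bsat M \<phi> e \<or> bsat M \<psi> e"
  and bsat_FIff: "bsat M (FIff \<phi> \<psi>) e \<longleftrightarrow> (bsat M \<phi> e \<longleftrightarrow> bsat M \<psi> e)"
  by (auto simp: FEx_def FOr_def FIff_def)

section \<open>Sets and Kuratowski pairs inside the universe\<close>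

locale nsu_universe =
  fixes U :: "'u nsu"
  assumes univ: "set_universe U"
begin

abbreviation E where "E \<equiv> Mem U"
abbreviation kp where "kp \<equiv> kpair U"

lemma
  shows not_atom: "E x a \<Longrightarrow> a \<notin> Atoms U"
    and extensional: "a \<notin> Atoms U \<Longrightarrow> b \<notin> Atoms U \<Longrightarrow> elts U a = elts U b \<Longrightarrow> a = b"
    and in_univ_subset: "in_univ U A \<Longrightarrow> B \<subseteq> A \<Longrightarrow> in_univ U B"
    and in_univ_pair: "in_univ U {x, a}"
    and in_univ_times: "in_univ U A \<Longrightarrow> in_univ U B \<Longrightarrow> in_univ U {kp x y | x y. x \<in> A \<and> y \<in> B}"
  using univ[unfolded set_universe_def]
  by (simp_all only: simp_thms)

lemma
  assumes "in_univ U A"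
  shows coll_not_atom: "coll U A \<notin> Atoms U" and elts_coll: "elts U (coll U A) = A"
proof -
  have "\<exists>!a. a \<notin> Atoms U \<and> elts U a = A"
    using assms extensional unfolding in_univ_def by blast
  then have "coll U A \<notin> Atoms U \<and> elts U (coll U A) = A"
    unfolding coll_def by (rule theI')
  then show "coll U A \<notin> Atoms U" "elts U (coll U A) = A" by auto
qed

lemma Mem_coll: "in_univ U A \<Longrightarrow> E x (coll U A) \<longleftrightarrow> x \<in> A"
  using elts_coll[of A] by (auto simp: elts_def)

lemma coll_eqI: "a \<notin> Atoms U \<Longrightarrow> elts U a = A \<Longrightarrow> coll U A = a"
  by (metis coll_not_atom elts_coll extensional in_univ_def)

lemma Mem_coll_pair: "E x (coll U {a, b}) \<longleftrightarrow> x = a \<or> x = b"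
  by (simp add: Mem_coll[OF in_univ_pair])

lemma Mem_coll_single: "E x (coll U {a}) \<longleftrightarrow> x = a"
  using Mem_coll_pair[of x a a] by simp

lemma kpair_Mem: "E a (kp x y) \<longleftrightarrow> a = coll U {x} \<or> a = coll U {x, y}"
  by (simp add: kpair_def Mem_coll_pair)

lemma kpair_eq_iff: "kp x y = kp x' y' \<longleftrightarrow> x = x' \<and> y = y'"
proof
  assume "kp x y = kp x' y'"
  then have "elts U (kp x y) = elts U (kp x' y')"
    by simp
  then have "{coll U {x}, coll U {x, y}} = {coll U {x'}, coll U {x', y'}}"
    unfolding kpair_def elts_coll[OF in_univ_pair] .
  moreover have "coll U {a, b} = coll U {c, d} \<longleftrightarrow> {a, b} = {c, d}" for a b c d
    using elts_coll[OF in_univ_pair] by metis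
  \<comment> \<open>The instances with repeated entries cover singletons.\<close>
  note this this[of a a for a, simplified] this[of _ _ c c for c, simplified] this[of a a c c for a c, simplified]
  ultimately show "x = x' \<and> y = y'"
    by (auto simp: doubleton_eq_iff)
qed simp

text \<open>The premises are what a bounded formula can say about a pair. Since \<open>p\<close>,
  \<open>a\<close> and \<open>b\<close> have members, they are not atoms, and extensionality
  applies.\<close>

lemma eq_kpairI:
  assumes "E a p" "E b p" "\<forall>c. E c p \<longrightarrow> c = a \<or> c = b"
    and "E x a" "\<forall>c. E c a \<longrightarrow> c = x"
    and "E x b" "E y b" "\<forall>c. E c b \<longrightarrow> c = x \<or> c = y"
  shows "p = kp x y"
proof -
  have "elts U a = {x}" "elts U b = {x, y}" "elts U p = {a, b}"
    using assms unfolding elts_def by blast+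
  then have "coll U {x} = a" "coll U {x, y} = b" "coll U {a, b} = p"
    using assms(1,4,6) by (auto intro: coll_eqI dest: not_atom)
  then show ?thesis by (simp add: kpair_def)
qed

text \<open>The bound variables of \<open>FPair\<close> are 10, 11, 12, and those of \<open>FMem2\<close> and \<open>FMem3\<close> below are 20, 21, 22;
  the arguments must avoid them.\<close>

definition FPair :: "nat \<Rightarrow> nat \<Rightarrow> nat \<Rightarrow> bformula" where
  "FPair p x y = FEx 10 p (FEx 11 p (BAnd (BAll 12 p (FOr (BEq 12 10) (BEq 12 11)))
     (BAnd (BAnd (BMem x 10) (BAll 12 10 (BEq 12 x)))
       (BAnd (BMem x 11) (BAnd (BMem y 11) (BAll 12 11 (FOr (BEq 12 x) (BEq 12 y))))))))"

lemma bsat_FPair: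
  assumes "p \<notin> {10, 11, 12}" "x \<notin> {10, 11, 12}" "y \<notin> {10, 11, 12}"
  shows "bsat E (FPair p x y) e \<longleftrightarrow> e p = kp (e x) (e y)"
proof -
  have "bsat E (FPair p x y) e \<longleftrightarrow>
    (\<exists>a. E a (e p) \<and> (\<exists>b. E b (e p) \<and> (\<forall>c. E c (e p) \<longrightarrow> c = a \<or> c = b) \<and>
      (E (e x) a \<and> (\<forall>c. E c a \<longrightarrow> c = e x)) \<and>
      E (e x) b \<and> E (e y) b \<and> (\<forall>c. E c b \<longrightarrow> c = e x \<or> c = e y)))"
    using assms by (simp add: FPair_def bsat_FEx bsat_FOr)
  also have "\<dots> \<longleftrightarrow> e p = kp (e x) (e y)" (is "?l \<longleftrightarrow> ?r")
  proof
    assume ?l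
    then obtain a b where "E a (e p)" "E b (e p)" "\<forall>c. E c (e p) \<longrightarrow> c = a \<or> c = b"
      "E (e x) a" "\<forall>c. E c a \<longrightarrow> c = e x" "E (e x) b" "E (e y) b" "\<forall>c. E c b \<longrightarrow> c = e x \<or> c = e y"
      by (elim exE conjE)
    then show ?r
      by (rule eq_kpairI)
  next
    assume ?r
    then show ?l
      by (intro exI[of _ "coll U {e x}"] exI[of _ "coll U {e x, e y}"] conjI)
        (simp_all add: kpair_Mem Mem_coll_pair Mem_coll_single)
  qed
  finally show ?thesis .
qed

section \<open>Bounded formulas for graphs of functions and operations\<close>

definition FMem2 :: "nat \<Rightarrow> nat \<Rightarrow> nat \<Rightarrow> bformula" where
  "FMem2 x y g = FEx 20 g (FPair 20 x y)"

text \<open>The inner pair is a member of a member of the outer one, so variables 21 and 22 reach it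
  by bounded quantifiers.\<close>

definition FMem3 :: "nat \<Rightarrow> nat \<Rightarrow> nat \<Rightarrow> nat \<Rightarrow> bformula" where
  "FMem3 x t y g = FEx 20 g (FEx 21 20 (FEx 22 21 (BAnd (FPair 20 22 y) (FPair 22 x t))))"

lemma bsat_FMem2:
  assumes "x < 10" "y < 10" "g < 10"
  shows "bsat E (FMem2 x y g) e \<longleftrightarrow> E (kp (e x) (e y)) (e g)"
  using assms by (auto simp: FMem2_def bsat_FEx bsat_FPair)

lemma bsat_FMem3:
  assumes "x < 10" "t < 10" "y < 10" "g < 10"
  shows "bsat E (FMem3 x t y g) e \<longleftrightarrow> E (kp (kp (e x) (e t)) (e y)) (e g)"
proof -
  have "bsat E (FMem3 x t y g) e \<longleftrightarrow> (\<exists>p. E p (e g) \<and> (\<exists>a. E a p \<and> (\<exists>q. E q a \<and>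
    p = kp q (e y) \<and> q = kp (e x) (e t))))"
    using assms by (simp add: FMem3_def bsat_FEx bsat_FPair)
  also have "\<dots> \<longleftrightarrow> E (kp (kp (e x) (e t)) (e y)) (e g)"
    by (metis kpair_Mem Mem_coll_single)
  finally show ?thesis .
qed

definition functional :: "'u \<Rightarrow> bool" where
  "functional g \<longleftrightarrow> (\<forall>z y w. E (kp z y) g \<longrightarrow> E (kp z w) g \<longrightarrow> y = w)"

text \<open>Components of a pair are members of its members: variables 1 and 5 hold the pairs, 2 and
  6 the intermediate members.\<close>

definition FFun :: "nat \<Rightarrow> bformula" where
  "FFun g = BAll 1 g (BAll 2 1 (BAll 3 2 (BAll 4 2 (BAll 5 g (BAll 6 5 (BAll 7 6
     (FOr (BNot (BAnd (FPair 1 3 4) (FPair 5 3 7))) (BEq 4 7))))))))"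

lemma bsat_FFun: "bsat E (FFun 0) e \<longleftrightarrow> functional (e 0)"
proof -
  have "bsat E (FFun 0) e \<longleftrightarrow> (\<forall>p. E p (e 0) \<longrightarrow> (\<forall>a. E a p \<longrightarrow> (\<forall>z. E z a \<longrightarrow> (\<forall>y. E y a \<longrightarrow>
    (\<forall>q. E q (e 0) \<longrightarrow> (\<forall>b. E b q \<longrightarrow> (\<forall>w. E w b \<longrightarrow> p = kp z y \<and> q = kp z w \<longrightarrow> y = w)))))))"
    by (simp add: FFun_def bsat_FOr bsat_FPair) blast
  also have "\<dots> \<longleftrightarrow> functional (e 0)" (is "?l \<longleftrightarrow> _")
  proof
    assume l: ?l
    show "functional (e 0)"
      unfolding functional_def
    proof (intro allI impI)
      fix z y w assume "E (kp z y) (e 0)" "E (kp z w) (e 0)"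
      then show "y = w"
        using l[rule_format, of "kp z y" "coll U {z, y}" z y "kp z w" "coll U {z, w}" w]
        by (simp add: kpair_Mem Mem_coll_pair)
    qed
  qed (auto simp: functional_def)
  finally show ?thesis .
qed

text \<open>Transfer of this property places the values of the extended sum in the hyper-extension
  of the carrier.\<close>

definition ranged :: "'u \<Rightarrow> 'u \<Rightarrow> bool" where
  "ranged g s \<longleftrightarrow> (\<forall>z y. E (kp z y) g \<longrightarrow> E y s)"

definition FRange :: "nat \<Rightarrow> nat \<Rightarrow> bformula" where
  "FRange g s = BAll 1 g (BAll 2 1 (BAll 3 2 (BAll 4 2 (FOr (BNot (FPair 1 3 4)) (BMem 4 s)))))"

lemma bsat_FRange: "bsat E (FRange 0 5) e \<longleftrightarrow> ranged (e 0) (e 5)"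
proof -
  have "bsat E (FRange 0 5) e \<longleftrightarrow> (\<forall>p. E p (e 0) \<longrightarrow> (\<forall>a. E a p \<longrightarrow> (\<forall>z. E z a \<longrightarrow> (\<forall>y. E y a \<longrightarrow>
    p = kp z y \<longrightarrow> E y (e 5)))))"
    by (simp add: FRange_def bsat_FOr bsat_FPair)
  also have "\<dots> \<longleftrightarrow> ranged (e 0) (e 5)" (is "?l \<longleftrightarrow> _")
  proof
    assume l: ?l
    show "ranged (e 0) (e 5)"
      unfolding ranged_def
    proof (intro allI impI)
      fix z y assume "E (kp z y) (e 0)"
      then show "E y (e 5)"
        using l[rule_format, of "kp z y" "coll U {z, y}" z y] by (simp add: kpair_Mem Mem_coll_pair)
    qed
  qed (auto simp: ranged_def)
  finally show ?thesis .
qed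

text \<open>Abstracted from \<open>star U\<close> so that its iterates are covered as well.\<close>

definition transfers :: "('u \<Rightarrow> 'u) \<Rightarrow> bool" where
  "transfers \<sigma> \<longleftrightarrow> (\<forall>a. a \<notin> Atoms U \<longrightarrow> \<sigma> a \<notin> Atoms U) \<and>
     (\<forall>\<phi> e. bsat E \<phi> e \<longleftrightarrow> bsat E \<phi> (\<lambda>i. \<sigma> (e i)))"

lemma transfers_funpow: "transfers \<sigma> \<Longrightarrow> transfers (\<sigma> ^^ k)"
proof (induction k)
  case (Suc k)
  then show ?case
    unfolding transfers_def by (auto simp: comp_def)
qed (simp add: transfers_def)

section \<open>Differences and preimages under transfer\<close>

context
  fixes \<sigma> :: "'u \<Rightarrow> 'u"
  assumes \<sigma>: "transfers \<sigma>"
begin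

lemma transfer: "bsat E \<phi> e \<longleftrightarrow> bsat E \<phi> (\<lambda>i. \<sigma> (e i))"
  using \<sigma> unfolding transfers_def by blast

lemma transfer_not_atom: "a \<notin> Atoms U \<Longrightarrow> \<sigma> a \<notin> Atoms U"
  using \<sigma> unfolding transfers_def by blast

lemma transfer_Mem: "E (\<sigma> x) (\<sigma> a) \<longleftrightarrow> E x a"
  using transfer[of "BMem 0 1" "(\<lambda>_. x)(1 := a)"] by simp

lemma transfer_functional: "functional g \<Longrightarrow> functional (\<sigma> g)"
  using transfer[of "FFun 0" "\<lambda>_. g"] by (simp add: bsat_FFun)

lemma transfer_ranged: "ranged g s \<Longrightarrow> ranged (\<sigma> g) (\<sigma> s)"
  using transfer[of "FRange 0 5" "(\<lambda>_. g)(5 := s)"] by (simp add: bsat_FRange)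

lemma transfer_Diff:
  assumes "in_univ U A" "in_univ U B"
  shows "elts U (\<sigma> (coll U (A - B))) = elts U (\<sigma> (coll U A)) - elts U (\<sigma> (coll U B))"
proof -
  let ?e = "(\<lambda>_. coll U A)(1 := coll U B, 2 := coll U (A - B))"
  have D: "in_univ U (A - B)"
    using in_univ_subset[OF assms(1)] by blast
  \<comment> \<open>Two bounded formulas describe the difference: \<open>A - B\<close> lies in
    \<open>A\<close> and misses \<open>B\<close>, and \<open>A\<close> is covered by
    \<open>B\<close> and \<open>A - B\<close>.\<close>
  have "bsat E (BAll 3 2 (BAnd (BMem 3 0) (BNot (BMem 3 1)))) ?e"
    "bsat E (BAll 3 0 (FOr (BMem 3 1) (BMem 3 2))) ?e"
    using assms D by (auto simp: Mem_coll bsat_FOr)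
  from this[THEN transfer[THEN iffD1]] show ?thesis
    by (auto simp: elts_def bsat_FOr)
qed

lemma transfer_preimage:
  assumes "\<And>x. E x s \<Longrightarrow> E x d \<longleftrightarrow> (\<exists>y. E y b \<and> E (kp x y) g)" and "E x (\<sigma> s)"
  shows "E x (\<sigma> d) \<longleftrightarrow> (\<exists>y. E y (\<sigma> b) \<and> E (kp x y) (\<sigma> g))"
proof -
  let ?\<phi> = "BAll 0 1 (FIff (BMem 0 2) (FEx 3 4 (FMem2 0 3 5)))"
  let ?e = "(\<lambda>_. s)(2 := d, 4 := b, 5 := g)"
  have "bsat E ?\<phi> ?e"
    using assms(1) by (simp add: bsat_FEx bsat_FIff bsat_FMem2)
  then have "bsat E ?\<phi> (\<lambda>i. \<sigma> (?e i))"
    by (rule transfer[THEN iffD1])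
  then show ?thesis
    using assms(2) by (simp add: bsat_FEx bsat_FIff bsat_FMem2)
qed

text \<open>The right summand \<open>t\<close> is a parameter of the formula and becomes
  \<open>\<sigma> t\<close>; this is the source of \<open>\<^sup>*\<beta>\<close> in
  \<open>\<alpha> + \<^sup>*\<beta>\<close>.\<close>

lemma transfer_preimage_left:
  assumes "\<And>x. E x s \<Longrightarrow> E x d \<longleftrightarrow> (\<exists>y. E y b \<and> E (kp (kp x t) y) g)" and "E x (\<sigma> s)"
  shows "E x (\<sigma> d) \<longleftrightarrow> (\<exists>y. E y (\<sigma> b) \<and> E (kp (kp x (\<sigma> t)) y) (\<sigma> g))"
proof -
  let ?\<phi> = "BAll 0 1 (FIff (BMem 0 2) (FEx 3 4 (FMem3 0 6 3 5)))"
  let ?e = "(\<lambda>_. s)(2 := d, 4 := b, 5 := g, 6 := t)"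
  have "bsat E ?\<phi> ?e"
    using assms(1) by (simp add: bsat_FEx bsat_FIff bsat_FMem3)
  then have "bsat E ?\<phi> (\<lambda>i. \<sigma> (?e i))"
    by (rule transfer[THEN iffD1])
  then show ?thesis
    using assms(2) by (simp add: bsat_FEx bsat_FIff bsat_FMem3)
qed

lemma transfer_preimage_right:
  assumes "\<And>x. E x s \<Longrightarrow> E x d \<longleftrightarrow> (\<exists>y. E y b \<and> E (kp (kp t x) y) g)" and "E x (\<sigma> s)"
  shows "E x (\<sigma> d) \<longleftrightarrow> (\<exists>y. E y (\<sigma> b) \<and> E (kp (kp (\<sigma> t) x) y) (\<sigma> g))"
proof -
  let ?\<phi> = "BAll 0 1 (FIff (BMem 0 2) (FEx 3 4 (FMem3 6 0 3 5)))"
  let ?e = "(\<lambda>_. s)(2 := d, 4 := b, 5 := g, 6 := t)"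
  have "bsat E ?\<phi> ?e"
    using assms(1) by (simp add: bsat_FEx bsat_FIff bsat_FMem3)
  then have "bsat E ?\<phi> (\<lambda>i. \<sigma> (?e i))"
    by (rule transfer[THEN iffD1])
  then show ?thesis
    using assms(2) by (simp add: bsat_FEx bsat_FIff bsat_FMem3)
qed

end

end


section \<open>Types of hyper-extension points\<close>

locale nonstandard_semigroup =
  fixes U :: "'u nsu" and L :: "'u layered" and \<delta> :: enat
  assumes framework: "nonstandard_framework U (carr L)"
    and adequate: "adequate_partial_layered_semigroup L \<delta>"
begin

sublocale nsu_universe U
  using framework unfolding nonstandard_framework_def by unfold_locales (elim conjE)

abbreviation S where "S \<equiv> carr L"

lemma transfers_star: "transfers (star U)"
  using framework unfolding nonstandard_framework_def transfers_def transfer_principle_def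
  by (elim conjE) (intro conjI)

lemmas transfers_stars = transfers_funpow[OF transfers_star]

lemma star_standard: "s \<in> S \<Longrightarrow> star U s = s"
  using framework unfolding nonstandard_framework_def by (elim conjE) (rule bspec)

lemma compact_hyp: "compact_space (topology_generated_by {hyp U B | B. B \<subseteq> S})"
  using framework unfolding nonstandard_framework_def by (elim conjE)

lemma S_univ: "in_univ U S"
  using framework unfolding nonstandard_framework_def by (elim conjE)

lemma subset_univ: "A \<subseteq> S \<Longrightarrow> in_univ U A"
  by (rule in_univ_subset[OF S_univ])

lemma partial_semigroup_L: "partial_semigroup L"
  using adequate unfolding adequate_partial_layered_semigroup_def by (elim conjE)

text \<open>\<open>hyp\<close> collects its argument anew at each level; as stars of sets are sets,
  this returns the iterated star itself.\<close>

lemma hypk_eq: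
  assumes "in_univ U A"
  shows "hypk U k A = elts U ((star U ^^ k) (coll U A))"
proof (induction k)
  case (Suc k)
  have "coll U (hypk U k A) = (star U ^^ k) (coll U A)"
    by (rule coll_eqI) (simp_all add: Suc transfer_not_atom[OF transfers_stars] coll_not_atom assms)
  then show ?case
    by (simp add: hypk_def hyp_def)
qed (simp add: hypk_def elts_coll assms)

lemma hypk_1: "hypk U 1 A = hyp U A" "hypk U (Suc 0) A = hyp U A"
  by (simp_all add: hypk_def)

lemma hyp_eq: "in_univ U A \<Longrightarrow> hyp U A = elts U (star U (coll U A))"
  by (simp add: hyp_def)

lemma hypk_Diff:
  assumes "A \<subseteq> S" "B \<subseteq> S"
  shows "hypk U k (A - B) = hypk U k A - hypk U k B"
proof -
  have "A - B \<subseteq> S"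
    using assms by blast
  then show ?thesis
    using assms by (simp add: hypk_eq subset_univ transfer_Diff[OF transfers_stars])
qed

lemma hypk_Int:
  assumes "A \<subseteq> S" "B \<subseteq> S"
  shows "hypk U k (A \<inter> B) = hypk U k A \<inter> hypk U k B"
proof -
  have "A - B \<subseteq> S"
    using assms by blast
  then have "hypk U k (A - (A - B)) = hypk U k A - (hypk U k A - hypk U k B)"
    using assms by (simp only: hypk_Diff)
  then show ?thesis
    by (simp only: Diff_Diff_Int)
qed

lemma hypk_mono: "B \<subseteq> S \<Longrightarrow> A \<subseteq> B \<Longrightarrow> hypk U k A \<subseteq> hypk U k B"
  using hypk_Int[of A B k] by (auto simp: inf_absorb1)

section \<open>Types as ultrafilters\<close>

text \<open>Intersecting with \<open>S\<close> makes the type a predicate on all sets while applying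
  \<open>hypk\<close> only to sets known to be in the universe.\<close>

definition utype :: "nat \<Rightarrow> 'u \<Rightarrow> 'u set \<Rightarrow> bool" where
  "utype k \<alpha> B \<longleftrightarrow> \<alpha> \<in> hypk U k (B \<inter> S)"

lemma ultrafil_utype:
  assumes "\<alpha> \<in> hypk U k S"
  shows "ultrafil (utype k \<alpha>)"
  unfolding ultrafil_def
proof (intro conjI allI)
  fix A B
  have "A \<inter> B \<inter> S = (A \<inter> S) \<inter> (B \<inter> S)" by blast
  then show "utype k \<alpha> (A \<inter> B) \<longleftrightarrow> utype k \<alpha> A \<and> utype k \<alpha> B"
    by (simp add: utype_def hypk_Int)
  have "- A \<inter> S = S - A \<inter> S" by blast
  then show "utype k \<alpha> (- A) \<longleftrightarrow> \<not> utype k \<alpha> A"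
    using assms by (simp add: utype_def hypk_Diff)
qed

lemma utype_S: "utype k \<alpha> S \<longleftrightarrow> \<alpha> \<in> hypk U k S"
  by (simp add: utype_def)

lemma hequiv_iff:
  "hequiv U L m \<alpha> n \<beta> \<longleftrightarrow> \<alpha> \<in> hypk U m S \<and> \<beta> \<in> hypk U n S \<and> utype m \<alpha> = utype n \<beta>"
proof -
  have "ultra U L m \<alpha> = ultra U L n \<beta> \<longleftrightarrow> (\<forall>B. B \<subseteq> S \<longrightarrow> (\<alpha> \<in> hypk U m B \<longleftrightarrow> \<beta> \<in> hypk U n B))"
    by (auto simp: ultra_def)
  also have "\<dots> \<longleftrightarrow> utype m \<alpha> = utype n \<beta>"
    unfolding fun_eq_iff utype_def by (metis inf.absorb1 inf_le2)
  finally show ?thesis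
    by (simp add: hequiv_def)
qed

text \<open>If no point lay in every \<open>hyp U B\<close> with \<open>u B\<close>, the sets
  \<open>hyp U (S - B)\<close> would cover \<open>hyp U S\<close>. A finite subcover then misses all
  points of some nonempty \<open>B \<subseteq> S\<close> with \<open>u B\<close>, contradicting
  compactness.\<close>

lemma realize_ultrafil:
  assumes u: "ultrafil u" "u S"
  obtains \<alpha> where "\<alpha> \<in> hypk U 1 S" "utype 1 \<alpha> = u"
proof -
  let ?T = "topology_generated_by {hyp U B | B. B \<subseteq> S}"
  have top: "topspace ?T = hyp U S"
    using hypk_mono[of S _ 1] unfolding hypk_1 topology_generated_by_topspace by blast
  have "\<exists>\<alpha>\<in>hyp U S. \<forall>B\<subseteq>S. u B \<longrightarrow> \<alpha> \<in> hyp U B"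
  proof (rule ccontr)
    assume none: "\<not> ?thesis"
    define \<C> where "\<C> = {hyp U (S - B) | B. B \<subseteq> S \<and> u B}"
    have "\<forall>C\<in>\<C>. openin ?T C"
      by (auto simp: \<C>_def intro!: topology_generated_by_Basis)
    moreover have "\<Union>\<C> = topspace ?T"
    proof
      show "\<Union>\<C> \<subseteq> topspace ?T"
        unfolding top \<C>_def using hypk_mono[of S _ 1] unfolding hypk_1 by blast
      show "topspace ?T \<subseteq> \<Union>\<C>"
      proof
        fix \<alpha> assume "\<alpha> \<in> topspace ?T"
        then obtain B where B: "B \<subseteq> S" "u B" "\<alpha> \<in> hyp U S - hyp U B"
          using none top by blast
        then have "\<alpha> \<in> hyp U (S - B)"
          using hypk_Diff[of S B 1] by (simp add: hypk_1)
        then show "\<alpha> \<in> \<Union>\<C>"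
          using B by (auto simp: \<C>_def)
      qed
    qed
    ultimately have "\<exists>\<D>. finite \<D> \<and> \<D> \<subseteq> \<C> \<and> \<Union>\<D> = topspace ?T"
      by (intro compact_hyp[unfolded compact_space, rule_format] conjI)
    then obtain \<D> where \<D>: "finite \<D>" "\<D> \<subseteq> \<C>" "\<Union>\<D> = topspace ?T"
      by (elim exE conjE)
    have "\<exists>B. B \<subseteq> S \<and> u B \<and> (\<forall>D\<in>\<D>. B \<inter> D = {})"
      using \<D>(1,2)
    proof (induction \<D>)
      case empty
      then show ?case using u by auto
    next
      case (insert D \<D>)
      then obtain B where B: "B \<subseteq> S" "u B" "\<forall>D\<in>\<D>. B \<inter> D = {}"
        by blast
      obtain C where C: "C \<subseteq> S" "u C" "D = hyp U (S - C)"
        using insert by (auto simp: \<C>_def)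
      \<comment> \<open>A standard point is its own star, so \<open>c\<close> lies in
        \<open>hyp U C\<close>, which is disjoint from \<open>hyp U (S - C)\<close>.\<close>
      have "c \<notin> hyp U (S - C)" if "c \<in> C" for c
      proof -
        have "star U c \<in> hyp U C"
          using that transfer_Mem[OF transfers_star, of c "coll U C"] subset_univ[OF C(1)]
          by (simp add: hyp_eq elts_def Mem_coll)
        then show ?thesis
          using hypk_Diff[of S C 1] that C(1) star_standard[of c] by (auto simp: hypk_1)
      qed
      then show ?case
        using B C u by (intro exI[of _ "B \<inter> C"]) (auto simp: ultrafil_Int)
    qed
    then obtain B where B: "B \<subseteq> S" "u B" "\<forall>D\<in>\<D>. B \<inter> D = {}"
      by blast
    obtain b where b: "b \<in> B"
      using ultrafil_nonempty[OF u(1) B(2)] by blast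
    then have "b \<in> S"
      using B(1) by blast
    then have "b \<in> hyp U S"
      using transfer_Mem[OF transfers_star, of b "coll U S"] star_standard[of b]
      by (simp add: hyp_eq[OF S_univ] elts_def Mem_coll[OF S_univ])
    then have "b \<in> \<Union>\<D>"
      by (simp only: \<D>(3) top)
    then show False
      using b B(3) by blast
  qed
  then obtain \<alpha> where \<alpha>: "\<alpha> \<in> hyp U S" "\<forall>B\<subseteq>S. u B \<longrightarrow> \<alpha> \<in> hyp U B"
    by (elim bexE)
  have imp: "utype 1 \<alpha> B" if "u B" for B
    using \<alpha>(2)[rule_format, of "B \<inter> S"] that u by (simp add: utype_def hypk_1 ultrafil_Int)
  have ut: "ultrafil (utype 1 \<alpha>)"
    using \<alpha>(1) by (intro ultrafil_utype) (simp add: hypk_1)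
  \<comment> \<open>Ultrafilters are maximal: one inclusion gives the other by complements.\<close>
  have "utype 1 \<alpha> B \<longleftrightarrow> u B" for B
    using imp[of B] imp[of "- B"] ultrafil_Compl[OF ut, of B] ultrafil_Compl[OF u(1), of B] by blast
  then show ?thesis
    using \<alpha>(1) by (intro that[of \<alpha>]) (auto simp: hypk_1)
qed

lemma happ_utype:
  assumes f: "f \<in> S \<rightarrow> S" and \<alpha>: "\<alpha> \<in> hypk U 1 S"
  shows "happ U L f \<alpha> \<in> hypk U 1 S" "utype 1 (happ U L f \<alpha>) = upush f (utype 1 \<alpha>)"
proof -
  define F where "F = {kp s (f s) | s. s \<in> S}"
  have F: "in_univ U F"
    by (rule in_univ_subset[OF in_univ_times[OF S_univ S_univ]]) (use f in \<open>auto simp: F_def\<close>)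
  have memF: "E (kp x y) (coll U F) \<longleftrightarrow> x \<in> S \<and> y = f x" for x y
    unfolding Mem_coll[OF F] by (auto simp: F_def kpair_eq_iff)
  have "functional (coll U F)"
    by (simp add: functional_def memF)
  then have func: "functional (star U (coll U F))"
    by (rule transfer_functional[OF transfers_star])
  \<comment> \<open>Transfer of the preimage under \<open>f\<close>. The case \<open>B = S\<close>
    later supplies the value at \<open>\<alpha>\<close>, and functionality its uniqueness.\<close>
  have pre: "\<alpha> \<in> hypk U 1 (f -` B \<inter> S) \<longleftrightarrow> (\<exists>y. y \<in> hypk U 1 (B \<inter> S) \<and> kp \<alpha> y \<in> hyp U F)" for B
  proof -
    have "E \<alpha> (star U (coll U (f -` B \<inter> S))) \<longleftrightarrow>
      (\<exists>y. E y (star U (coll U (B \<inter> S))) \<and> E (kp \<alpha> y) (star U (coll U F)))"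
    proof (rule transfer_preimage[OF transfers_star, where s = "coll U S"])
      show "E \<alpha> (star U (coll U S))"
        using \<alpha> by (simp add: hypk_1 hyp_eq[OF S_univ] elts_def)
      show "E x (coll U (f -` B \<inter> S)) \<longleftrightarrow> (\<exists>y. E y (coll U (B \<inter> S)) \<and> E (kp x y) (coll U F))"
        if "E x (coll U S)" for x
        using that f by (auto simp: memF Mem_coll subset_univ S_univ)
    qed
    then show ?thesis
      by (simp add: hypk_1 hyp_eq subset_univ F elts_def)
  qed
  have uniq: "y = w" if "kp \<alpha> y \<in> hyp U F" "kp \<alpha> w \<in> hyp U F" for y w
    using func that by (auto simp: functional_def hyp_eq[OF F] elts_def)
  have "f -` S \<inter> S = S"
    using f by blast
  then obtain y where y: "y \<in> hypk U 1 S" "kp \<alpha> y \<in> hyp U F"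
    using pre[of S] \<alpha> by auto
  have happ: "happ U L f \<alpha> = y"
    unfolding happ_def F_def[symmetric] by (rule the_equality) (use y uniq in auto)
  show "happ U L f \<alpha> \<in> hypk U 1 S"
    by (simp only: happ y)
  show "utype 1 (happ U L f \<alpha>) = upush f (utype 1 \<alpha>)"
    unfolding fun_eq_iff happ upush_def utype_def pre using y uniq by blast
qed

section \<open>The extended partial sum\<close>

lemma sum_graph_univ: "in_univ U (sum_graph U L)"
proof (rule in_univ_subset)
  show "in_univ U {kp p u | p u. p \<in> {kp s t | s t. s \<in> S \<and> t \<in> S} \<and> u \<in> S}"
    by (intro in_univ_times S_univ)
  show "sum_graph U L \<subseteq> {kp p u | p u. p \<in> {kp s t | s t. s \<in> S \<and> t \<in> S} \<and> u \<in> S}"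
    using partial_semigroup_closed[OF partial_semigroup_L] unfolding sum_graph_def by blast
qed

lemma Mem_sum_graph:
  "E (kp (kp x y) z) (coll U (sum_graph U L)) \<longleftrightarrow> x \<in> S \<and> y \<in> S \<and> psum L x y = Some z"
  unfolding Mem_coll[OF sum_graph_univ] by (auto simp: sum_graph_def kpair_eq_iff)

lemma functional_sum_graph: "functional (coll U (sum_graph U L))"
  unfolding functional_def Mem_coll[OF sum_graph_univ] by (auto simp: sum_graph_def kpair_eq_iff)

lemma ranged_sum_graph: "ranged (coll U (sum_graph U L)) (coll U S)"
  using partial_semigroup_closed[OF partial_semigroup_L]
  unfolding ranged_def Mem_coll[OF sum_graph_univ] Mem_coll[OF S_univ]
  by (auto simp: sum_graph_def kpair_eq_iff)

text \<open>Brings \<open>hsum\<close> into a form to which transfer applies; the value is unique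
  because functionality of the graph transfers.\<close>

lemma hsum_eq_Some_iff:
  "hsum U L k \<alpha> \<beta> = Some \<gamma> \<longleftrightarrow> E (kp (kp \<alpha> \<beta>) \<gamma>) ((star U ^^ k) (coll U (sum_graph U L)))"
proof -
  have uniq: "functional ((star U ^^ k) (coll U (sum_graph U L)))"
    by (rule transfer_functional[OF transfers_stars functional_sum_graph])
  have mem: "p \<in> hypk U k (sum_graph U L) \<longleftrightarrow> E p ((star U ^^ k) (coll U (sum_graph U L)))" for p
    by (simp add: hypk_eq[OF sum_graph_univ] elts_def)
  show ?thesis
  proof
    assume "hsum U L k \<alpha> \<beta> = Some \<gamma>"
    then obtain \<gamma>' where "E (kp (kp \<alpha> \<beta>) \<gamma>') ((star U ^^ k) (coll U (sum_graph U L)))"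
      and "\<gamma> = (THE \<gamma>. E (kp (kp \<alpha> \<beta>) \<gamma>) ((star U ^^ k) (coll U (sum_graph U L))))"
      by (auto simp: hsum_def mem split: if_splits)
    then show "E (kp (kp \<alpha> \<beta>) \<gamma>) ((star U ^^ k) (coll U (sum_graph U L)))"
      using uniq by (metis (mono_tags, lifting) functional_def theI)
  next
    assume \<gamma>: "E (kp (kp \<alpha> \<beta>) \<gamma>) ((star U ^^ k) (coll U (sum_graph U L)))"
    then have "(THE \<gamma>. E (kp (kp \<alpha> \<beta>) \<gamma>) ((star U ^^ k) (coll U (sum_graph U L)))) = \<gamma>"
      using uniq by (intro the_equality) (auto simp: functional_def)
    then show "hsum U L k \<alpha> \<beta> = Some \<gamma>"
      using \<gamma> by (auto simp: hsum_def mem)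
  qed
qed

text \<open>The set of \<open>y\<close> with \<open>x + y\<close> in \<open>B\<close> is
  transferred; the parameter \<open>x\<close> is its own star.\<close>

lemma hsum_standard_left:
  assumes x: "x \<in> S" and \<alpha>: "\<alpha> \<in> hypk U 1 S"
  shows "utype 1 \<alpha> {y. \<exists>z\<in>B. psum L x y = Some z} \<longleftrightarrow>
    (\<exists>\<gamma>. \<gamma> \<in> hypk U 1 (B \<inter> S) \<and> hsum U L 1 x \<alpha> = Some \<gamma>)"
proof -
  let ?D = "{y. \<exists>z\<in>B. psum L x y = Some z} \<inter> S"
  have "E \<alpha> (star U (coll U ?D)) \<longleftrightarrow> (\<exists>y. E y (star U (coll U (B \<inter> S))) \<and>
    E (kp (kp (star U x) \<alpha>) y) (star U (coll U (sum_graph U L))))"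
  proof (rule transfer_preimage_right[OF transfers_star, where s = "coll U S"])
    show "E \<alpha> (star U (coll U S))"
      using \<alpha> by (simp add: hypk_1 hyp_eq[OF S_univ] elts_def)
    show "E y (coll U ?D) \<longleftrightarrow> (\<exists>z. E z (coll U (B \<inter> S)) \<and> E (kp (kp x y) z) (coll U (sum_graph U L)))"
      if "E y (coll U S)" for y
      using that x partial_semigroup_closed[OF partial_semigroup_L x, of y]
      by (auto simp: Mem_sum_graph Mem_coll subset_univ S_univ)
  qed
  then show ?thesis
    by (simp add: utype_def hypk_1 hyp_eq subset_univ elts_def hsum_eq_Some_iff star_standard[OF x])
qed

lemma hsum_defined_iff:
  assumes x: "x \<in> S" and \<alpha>: "\<alpha> \<in> hypk U 1 S"
  shows "hsum U L 1 x \<alpha> \<noteq> None \<longleftrightarrow> utype 1 \<alpha> {y. psum L x y \<noteq> None}"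
proof -
  have "\<gamma> \<in> hypk U 1 S" if "hsum U L 1 x \<alpha> = Some \<gamma>" for \<gamma>
    using that transfer_ranged[OF transfers_stars ranged_sum_graph, of 1]
    by (auto simp: hsum_eq_Some_iff hypk_eq[OF S_univ] ranged_def elts_def)
  then show ?thesis
    using hsum_standard_left[OF x \<alpha>, of UNIV] by auto
qed

text \<open>For \<open>x\<close> in \<open>S\<close>, the condition that \<open>x + \<beta>\<close>
  lies in the star of \<open>B\<close> is already a statement about stars. Transferring it in
  \<open>x\<close> and evaluating at \<open>\<alpha>\<close> replaces \<open>\<beta>\<close> by
  \<open>\<^sup>*\<beta>\<close> and each star by a double star.\<close>

lemma hsum_2:
  assumes \<alpha>: "\<alpha> \<in> hypk U 1 S" and \<beta>: "\<beta> \<in> hypk U 1 S"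
    and def: "\<And>x. x \<in> S \<Longrightarrow> utype 1 \<beta> {y. psum L x y \<noteq> None}"
  obtains \<gamma> where "hsum U L 2 \<alpha> (star U \<beta>) = Some \<gamma>" "\<gamma> \<in> hypk U 2 S"
    "utype 2 \<gamma> = usum (psum L) (utype 1 \<alpha>) (utype 1 \<beta>)"
proof -
  have key: "usum (psum L) (utype 1 \<alpha>) (utype 1 \<beta>) B \<longleftrightarrow>
    (\<exists>\<gamma>. \<gamma> \<in> hypk U 2 (B \<inter> S) \<and> hsum U L 2 \<alpha> (star U \<beta>) = Some \<gamma>)" for B
  proof -
    let ?D = "{x. utype 1 \<beta> {y. \<exists>z\<in>B. psum L x y = Some z}} \<inter> S"
    have "E \<alpha> (star U (coll U ?D)) \<longleftrightarrow> (\<exists>y. E y (star U (star U (coll U (B \<inter> S)))) \<and>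
      E (kp (kp \<alpha> (star U \<beta>)) y) (star U (star U (coll U (sum_graph U L)))))"
    proof (rule transfer_preimage_left[OF transfers_star, where s = "coll U S"])
      show "E \<alpha> (star U (coll U S))"
        using \<alpha> by (simp add: hypk_1 hyp_eq[OF S_univ] elts_def)
      show "E x (coll U ?D) \<longleftrightarrow> (\<exists>z. E z (star U (coll U (B \<inter> S))) \<and>
        E (kp (kp x \<beta>) z) (star U (coll U (sum_graph U L))))" if "E x (coll U S)" for x
      proof -
        have x: "x \<in> S"
          using that by (simp add: Mem_coll S_univ)
        then have "E x (coll U ?D) \<longleftrightarrow> utype 1 \<beta> {y. \<exists>z\<in>B. psum L x y = Some z}"
          by (simp add: Mem_coll subset_univ)
        then show ?thesis
          using hsum_standard_left[OF x \<beta>, of B]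
          by (simp add: hypk_1 hyp_eq subset_univ elts_def hsum_eq_Some_iff)
      qed
    qed
    then show ?thesis
      by (simp add: usum_def utype_def[of "Suc 0" \<alpha>] hypk_1 hyp_eq hypk_eq subset_univ elts_def
          hsum_eq_Some_iff numeral_2_eq_2)
  qed
  \<comment> \<open>Existence of the sum: an ultrafilter contains \<open>UNIV\<close>, to which
    \<open>key\<close> applies.\<close>
  have "ultrafil (usum (psum L) (utype 1 \<alpha>) (utype 1 \<beta>))"
    using \<alpha> \<beta> def by (intro ultrafil_usum[where S = S] ultrafil_utype) (auto simp: utype_S)
  then have "usum (psum L) (utype 1 \<alpha>) (utype 1 \<beta>) UNIV"
    by (metis Int_UNIV_right ultrafil_Compl ultrafil_Int)
  then obtain \<gamma> where "\<gamma> \<in> hypk U 2 S" "hsum U L 2 \<alpha> (star U \<beta>) = Some \<gamma>"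
    using key[of UNIV] by auto
  then show ?thesis
    using key by (intro that[of \<gamma>]) (auto simp: utype_def fun_eq_iff)
qed

text \<open>Together with \<open>hpreceq_iff\<close>, the dictionary between points and
  ultrafilters.\<close>

lemma gam_layer_iff: "\<alpha> \<in> gam U L (layer L i) \<longleftrightarrow> \<alpha> \<in> hypk U 1 S \<and> utype 1 \<alpha> \<in> cofinal_layer L i"
proof -
  have "layer L i \<inter> S = layer L i" "layer L i \<subseteq> S"
    by (auto simp: layer_def)
  moreover have "hyp U (layer L i) \<subseteq> hyp U S"
    using hypk_mono[of S "layer L i" 1] by (simp add: hypk_1 layer_def)
  ultimately show ?thesis
    using ultrafil_utype[of \<alpha> 1] hsum_defined_iff[of _ \<alpha>] unfolding gam_def cofinal_layer_def
    by (auto simp: utype_def hypk_1)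
qed

lemma hpreceq_iff:
  assumes "\<alpha> \<in> gam U L (layer L i)" "\<beta> \<in> gam U L (layer L j)"
  shows "hpreceq U L \<alpha> \<beta> \<longleftrightarrow> usum (psum L) (utype 1 \<alpha>) (utype 1 \<beta>) = utype 1 \<alpha> \<and>
    usum (psum L) (utype 1 \<beta>) (utype 1 \<alpha>) = utype 1 \<alpha>"
proof -
  have \<alpha>: "\<alpha> \<in> hypk U 1 S" and \<beta>: "\<beta> \<in> hypk U 1 S"
    and cof: "utype 1 \<alpha> \<in> cofinal_layer L i" "utype 1 \<beta> \<in> cofinal_layer L j"
    using assms by (simp_all add: gam_layer_iff)
  obtain \<gamma> \<gamma>' where "hsum U L 2 \<alpha> (star U \<beta>) = Some \<gamma>" "\<gamma> \<in> hypk U 2 S"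
    "utype 2 \<gamma> = usum (psum L) (utype 1 \<alpha>) (utype 1 \<beta>)"
    "hsum U L 2 \<beta> (star U \<alpha>) = Some \<gamma>'" "\<gamma>' \<in> hypk U 2 S"
    "utype 2 \<gamma>' = usum (psum L) (utype 1 \<beta>) (utype 1 \<alpha>)"
    using hsum_2[OF \<alpha> \<beta> cofinal_layerD(4)[OF cof(2)]] hsum_2[OF \<beta> \<alpha> cofinal_layerD(4)[OF cof(1)]]
    by metis
  then show ?thesis
    using \<alpha> by (auto simp: hpreceq_def hequiv_iff)
qed

end


section \<open>Ramsey elements\<close>

text \<open>Reindexing a sequence of length \<open>\<delta>\<close> along \<open>m\<close> repeats its last term forever, which reduces finite \<open>\<delta>\<close>
  to sequences indexed by all natural numbers.\<close>

lemma truncate_index: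
  assumes "\<delta> \<noteq> 0"
  obtains m :: "nat \<Rightarrow> nat" where "\<And>i. enat (m i) < \<delta>" "\<And>i. enat i < \<delta> \<Longrightarrow> m i = i"
    "\<And>i j. m (max i j) = max (m i) (m j)" "\<And>i. m (Suc i) = m i \<or> m (Suc i) = Suc (m i)"
proof (cases \<delta>)
  case (enat n)
  \<comment> \<open>\<open>n - 1\<close> is the last index, since \<open>\<delta> \<noteq> 0\<close>
    gives \<open>n > 0\<close>.\<close>
  then show ?thesis
    using assms by (intro that[of "\<lambda>i. min i (n - 1)"]) (auto simp: zero_enat_def)
next
  case infinity
  then show ?thesis
    by (intro that[of "\<lambda>i. i"]) auto
qed

context nonstandard_semigroup
begin

text \<open>The type of \<open>\<beta>\<close> contains the layer of index
  \<open>layer_shift L f i\<close>, as an image, and the layer of index \<open>k\<close>; distinct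
  layers are disjoint.\<close>

lemma gam_upush_unique:
  assumes f: "regressive L f" and \<alpha>: "\<alpha> \<in> gam U L (layer L i)" and \<beta>: "\<beta> \<in> gam U L (layer L k)"
    and eq: "upush f (utype 1 \<alpha>) = utype 1 \<beta>"
  shows "k = layer_shift L f i"
proof -
  note a = cofinal_layerD[OF conjunct2[OF \<alpha>[unfolded gam_layer_iff]]]
    and b = cofinal_layerD[OF conjunct2[OF \<beta>[unfolded gam_layer_iff]]]
  have "utype 1 \<alpha> (f -` layer L (layer_shift L f i))"
    by (rule ultrafil_mono[OF a(1,2) regressive_layer[OF f]])
  then have "utype 1 \<beta> (layer L (layer_shift L f i))"
    unfolding eq[symmetric] upush_def .
  then have "utype 1 \<beta> (layer L (layer_shift L f i) \<inter> layer L k)"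
    using b by (simp add: ultrafil_Int)
  then show ?thesis
    using ultrafil_nonempty[OF b(1)] by (force simp: layer_def)
qed

text \<open>The types of the given element form a coherent sequence; an absorbing one replaces it
  and is realized by points.\<close>

theorem coherent_imp_is_ramsey:
  assumes reg: "\<And>f. f \<in> \<F> \<Longrightarrow> regressive L f" and coh: "coherent_element U L \<delta> \<F> \<alpha>"
  shows "is_ramsey U L \<delta> \<F>"
proof (cases "\<delta> = 0")
  \<comment> \<open>There are no indices, so the given element is itself Ramsey.\<close>
  case True
  then show ?thesis
    using coh unfolding is_ramsey_def ramsey_element_def coherent_element_def by auto
next
  case False
  obtain m :: "nat \<Rightarrow> nat" where m_less: "\<And>i. enat (m i) < \<delta>" and m_eq: "\<And>i. enat i < \<delta> \<Longrightarrow> m i = i"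
    and m_max: "\<And>i j. m (max i j) = max (m i) (m j)" and m_Suc: "\<And>i. m (Suc i) = m i \<or> m (Suc i) = Suc (m i)"
    using truncate_index[OF False] by blast
  have less: "enat k < \<delta>" if "k \<le> j" "enat j < \<delta>" for k j
    using that by (meson enat_ord_simps(1) le_less_trans)
  have \<alpha>: "\<alpha> i \<in> gam U L (layer L i)" if "enat i < \<delta>" for i
    using coh that unfolding coherent_element_def Pi_gam_def by (elim conjE) (erule PiE_mem, simp)
  \<comment> \<open>Index \<open>i\<close> stands for the layer \<open>m i\<close>, so the shift is
    composed with \<open>m\<close>.\<close>
  define H where "H = (\<lambda>f. (upush f, \<lambda>i. layer_shift L f (m i))) ` \<F>"
  interpret layered_compact_semigroup pointwise_topology "usum (psum L)" "\<lambda>i. cofinal_layer L (m i)" H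
  proof
    fix i j k h g a b c
    show "usum (psum L) a b \<in> cofinal_layer L (m (max i j))"
      if "a \<in> cofinal_layer L (m i)" "b \<in> cofinal_layer L (m j)"
      using usum_layer[OF adequate that] by (simp add: m_max)
    show "usum (psum L) (usum (psum L) a b) c = usum (psum L) a (usum (psum L) b c)"
      if "a \<in> cofinal_layer L (m i)" "b \<in> cofinal_layer L (m j)" "c \<in> cofinal_layer L (m k)"
      by (rule usum_assoc[OF partial_semigroup_L that])
    assume "(h, g) \<in> H"
    then obtain f where f: "regressive L f" and h: "h = upush f" and g: "g = (\<lambda>i. layer_shift L f (m i))"
      using reg by (auto simp: H_def)
    show "continuous_map pointwise_topology pointwise_topology h"
      unfolding h by (rule continuous_upush)
    show "h (usum (psum L) a b) = usum (psum L) (h a) (h b)"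
      if "a \<in> cofinal_layer L (m i)" "b \<in> cofinal_layer L (m j)"
      unfolding h by (rule upush_usum[OF that regressive_sum[OF f]])
    show "g 0 = 0"
      using layer_shift_le[OF f adequate, of 0] False m_eq[of 0]
      by (simp add: g zero_enat_def[symmetric] i0_less)
    show "g (Suc i) = g i \<or> g (Suc i) = Suc (g i)"
      using m_Suc[of i] layer_shift_Suc[OF f adequate, of "m i"] m_less[of "Suc i"] by (auto simp: g)
  qed (rule compact_pointwise Hausdorff_pointwise topspace_pointwise closedin_cofinal_layer continuous_usum)+
  have "coherent (\<lambda>i. utype 1 (\<alpha> (m i)))"
  proof (rule coherentI)
    show "utype 1 (\<alpha> (m i)) \<in> cofinal_layer L (m i)" for i
      using \<alpha>[OF m_less] by (simp add: gam_layer_iff)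
    fix h g i
    assume "(h, g) \<in> H"
    then obtain f where f: "f \<in> \<F>" and h: "h = upush f" and g: "g = (\<lambda>i. layer_shift L f (m i))"
      by (auto simp: H_def)
    obtain k where k: "k \<le> m i" "hequiv U L 1 (happ U L f (\<alpha> (m i))) 1 (\<alpha> k)"
      using coh f m_less[of i] unfolding coherent_element_def by blast
    have "\<alpha> (m i) \<in> hypk U 1 S"
      using \<alpha>[OF m_less] by (simp only: gam_layer_iff)
    then have eq: "upush f (utype 1 (\<alpha> (m i))) = utype 1 (\<alpha> k)"
      using k(2) happ_utype(2)[OF regressive_maps[OF reg[OF f]]] by (simp add: hequiv_iff)
    \<comment> \<open>Coherence supplies only some \<open>k \<le> m i\<close>; disjointness of
      layers identifies it. As \<open>k\<close> is below \<open>\<delta>\<close>, reindexing by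
      \<open>m\<close> fixes it.\<close>
    have "k = layer_shift L f (m i)"
      by (rule gam_upush_unique[OF reg[OF f] \<alpha>[OF m_less] \<alpha>[OF less[OF k(1) m_less]] eq])
    then show "h (utype 1 (\<alpha> (m i))) = utype 1 (\<alpha> (m (g i)))"
      using eq m_eq[OF less[OF k(1) m_less]] by (simp add: h g)
  qed
  then obtain v where v: "coherent v" and absorb: "\<And>i j. i \<le> j \<Longrightarrow> usum (psum L) (v j) (v i) = v j"
    "\<And>i j. i \<le> j \<Longrightarrow> usum (psum L) (v i) (v j) = v j"
    by (rule coherent_absorbing) blast
  have "\<exists>\<beta>. \<forall>i. \<beta> i \<in> hypk U 1 S \<and> utype 1 (\<beta> i) = v i"
  proof (rule choice, rule allI)
    fix i
    show "\<exists>b. b \<in> hypk U 1 S \<and> utype 1 b = v i"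
      using realize_ultrafil[OF cofinal_layerD(1,3)[OF coherent_layer[OF v]], of i] by metis
  qed
  then obtain \<beta>' where \<beta>': "\<And>i. \<beta>' i \<in> hypk U 1 S" "\<And>i. utype 1 (\<beta>' i) = v i"
    by blast
  \<comment> \<open>\<open>Pi_gam\<close> consists of extensional functions, so values at indices
    outside the range are cut off.\<close>
  define \<beta> where "\<beta> = restrict \<beta>' {i. enat i < \<delta>}"
  have \<beta>: "\<beta> i \<in> hypk U 1 S" "utype 1 (\<beta> i) = v i" if "enat i < \<delta>" for i
    using that \<beta>' by (simp_all add: \<beta>_def)
  have gam: "\<beta> i \<in> gam U L (layer L i)" if "enat i < \<delta>" for i
    using \<beta>[OF that] coherent_layer[OF v, of i] m_eq[OF that] by (simp add: gam_layer_iff)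
  then have Pi: "\<beta> \<in> Pi_gam U L \<delta>"
    by (auto simp: Pi_gam_def \<beta>_def)
  have "\<exists>k\<le>j. hequiv U L 1 (happ U L f (\<beta> j)) 1 (\<beta> k)" if f: "f \<in> \<F>" and j: "enat j < \<delta>" for f j
  proof (intro exI conjI)
    have maps: "f \<in> S \<rightarrow> S"
      by (rule regressive_maps[OF reg[OF f]])
    show le: "layer_shift L f j \<le> j"
      by (rule layer_shift_le[OF reg[OF f] adequate j])
    have "(upush f, \<lambda>i. layer_shift L f (m i)) \<in> H"
      using f by (auto simp: H_def)
    from coherent_hom[OF v this, of j] have "upush f (v j) = v (layer_shift L f j)"
      by (simp add: m_eq[OF j])
    then show "hequiv U L 1 (happ U L f (\<beta> j)) 1 (\<beta> (layer_shift L f j))"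
      using happ_utype[OF maps \<beta>(1)[OF j]] \<beta>[OF j] \<beta>[OF less[OF le j]] by (simp add: hequiv_iff)
  qed
  moreover have "hpreceq U L (\<beta> j) (\<beta> i)" if "i \<le> j" "enat j < \<delta>" for i j
    using hpreceq_iff[OF gam[OF that(2)] gam[OF less[OF that]]] \<beta>(2)[OF that(2)] \<beta>(2)[OF less[OF that]]
      absorb[OF that(1)] by simp
  ultimately have "ramsey_element U L \<delta> \<F> \<beta>"
    using Pi by (simp add: ramsey_element_def coherent_element_def)
  then show ?thesis
    using Pi unfolding is_ramsey_def by blast
qed

end

theorem theorem5p8:
  fixes U :: "'u nsu" and L :: "'u layered" and \<delta> :: enat and \<F> :: "('u \<Rightarrow> 'u) set"
  assumes "nonstandard_framework U (carr L)"
    and "adequate_partial_layered_semigroup L \<delta>"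
    and "\<And>f. f \<in> \<F> \<Longrightarrow> regressive L f"
    and "locally_finite L \<F>"
    and "\<exists>\<alpha>. coherent_element U L \<delta> \<F> \<alpha>"
  shows "is_ramsey U L \<delta> \<F>"
proof -
  interpret nonstandard_semigroup U L \<delta>
    using assms(1,2) by unfold_locales
  show ?thesis
    using assms(3,5) coherent_imp_is_ramsey by blast
qed

end
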